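(* Let $s \geq t \geq 2$ be fixed integers and let $G$ be a $K_{s,t}$-free graph with minimum degree $d$. Let $T$ be a tree with $|T| \leq \frac{1}{64} s^{-1/(t-1)} d^{t/(t-1)}$ and maximum degree $\Delta(T) \leq \frac{1}{64t} d$. Then Algorithm 2 (described in the context) finds an embedding of $T$ in $G$ with high probability, i.e. with probability tending to $1$ as $d\to\infty$.
   Context: $K_{s,t}$ denotes the complete bipartite graph with parts of sizes $s$ and $t$; $G$ is $K_{s,t}$-free if it contains no (not necessarily induced) subgraph isomorphic to $K_{s,t}$. $|T|$ denotes the number of vertices of $T$. An embedding of $T$ in $G$ is an injective map $f:V(T)\to V(G)$ mapping edges to edges. Algorithm 2: for each vertex $v\in V(G)$ fix a set $N_+(v)\subseteq N(v)$ of exactly $d$ neighbors. Choose a root $r$ of $T$ and embed it at an arbitrary vertex $f(r)\in V(G)$. As long as $T$ is not completely embedded, take an arbitrary vertex $u\in V(T)$ which is embedded but whose children are not. If $N_+(f(u))$ contains enough vertices not occupied by other vertices of $T$, embed the children of $u$ one by one, each at a vertex chosen uniformly at random from the currently unoccupied vertices of $N_+(f(u))$, and continue; otherwise the algorithm fails. *)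

theory Defs
  imports "HOL-Probability.SPMF" "Graph_Theory.Kuratowski"
begin

text \<open>
  Finite simple graphs are \<^locale>\<open>pair_graph\<close>s: finite, symmetric, loop-free sets of arcs, every
  undirected edge being present as its two orientations. Hence \<^const>\<open>out_degree\<close> is the degree.
\<close>

definition neighbours :: "'a pair_pre_digraph \<Rightarrow> 'a \<Rightarrow> 'a set" where
  "neighbours G v = {w. (v, w) \<in> parcs G}"

definition min_degree :: "'a pair_pre_digraph \<Rightarrow> nat" where
  "min_degree G = Min (out_degree (with_proj G) ` pverts G)"

definition max_degree :: "'a pair_pre_digraph \<Rightarrow> nat" where
  "max_degree G = Max (out_degree (with_proj G) ` pverts G)"

text \<open>Subgraphs need not be induced.\<close>

definition Kst_free :: "nat \<Rightarrow> nat \<Rightarrow> 'a pair_pre_digraph \<Rightarrow> bool" where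
  "Kst_free s t G \<longleftrightarrow> \<not> (\<exists>H. subgraph H (with_proj G) \<and> complete_bipartite_digraph s t H)"

text \<open>
  \<^const>\<open>tree\<close> from the library is about directed cycles: it counts the two orientations of an
  edge as a cycle of length 2, and so rejects every symmetric digraph with an edge. Cycles of an
  undirected simple graph are those of length at least 3. Note that
  \<^const>\<open>Digraph_Component.connected\<close> includes non-emptiness.
\<close>

definition tree_graph :: "'b pair_pre_digraph \<Rightarrow> bool" where
  "tree_graph T \<longleftrightarrow> pair_graph T \<and> Digraph_Component.connected (with_proj T)
     \<and> \<not> (\<exists>p. pre_digraph.cycle (with_proj T) p \<and> 3 \<le> length p)"

definition is_embedding :: "'b pair_pre_digraph \<Rightarrow> 'a pair_pre_digraph \<Rightarrow> ('b \<Rightarrow> 'a) \<Rightarrow> bool" where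
  "is_embedding T G f \<longleftrightarrow> f ` pverts T \<subseteq> pverts G \<and> inj_on f (pverts T)
     \<and> (\<forall>(u, w) \<in> parcs T. (f u, f w) \<in> parcs G)"

text \<open>
  The children of \<open>u\<close> in \<open>T\<close> rooted at \<open>r\<close>: the vertices \<open>w\<close> whose predecessor on the path from
  \<open>r\<close> to \<open>w\<close> is \<open>u\<close>.
\<close>

definition children :: "'b pair_pre_digraph \<Rightarrow> 'b \<Rightarrow> 'b \<Rightarrow> 'b set" where
  "children T r u = {w. \<exists>p. pre_digraph.apath (with_proj T) r (p @ [(u, w)]) w}"

text \<open>
  The state of the algorithm is its whole history: the list of pairs (vertex of \<open>T\<close>, its image),
  in the order in which they were embedded.
\<close>

type_synonym ('b, 'a) history = "('b \<times> 'a) list"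

definition embedded :: "('b, 'a) history \<Rightarrow> 'b set" where
  "embedded h = fst ` set h"

definition occupied :: "('b, 'a) history \<Rightarrow> 'a set" where
  "occupied h = snd ` set h"

definition embedding_of :: "('b, 'a) history \<Rightarrow> 'b \<Rightarrow> 'a" where
  "embedding_of h u = the (map_of h u)"

text \<open>
  The arbitrary choices of the algorithm are made by a strategy that may depend on the whole
  history: \<open>pick h\<close> is the vertex processed next, and \<open>ord h u\<close> lists the children of \<open>u\<close> in the
  order in which they are to be embedded.
\<close>

definition pickable :: "'b pair_pre_digraph \<Rightarrow> 'b \<Rightarrow> ('b, 'a) history \<Rightarrow> 'b set" where
  "pickable T r h =
     {u \<in> embedded h. children T r u \<noteq> {} \<and> children T r u \<inter> embedded h = {}}"

definition valid_strategy ::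
  "'b pair_pre_digraph \<Rightarrow> 'b \<Rightarrow> (('b, 'a) history \<Rightarrow> 'b) \<Rightarrow> (('b, 'a) history \<Rightarrow> 'b \<Rightarrow> 'b list) \<Rightarrow> bool"
  where
  "valid_strategy T r pick ord \<longleftrightarrow>
     (\<forall>h. pickable T r h \<noteq> {} \<longrightarrow> pick h \<in> pickable T r h) \<and>
     (\<forall>h. \<forall>u \<in> pverts T. distinct (ord h u) \<and> set (ord h u) = children T r u)"

text \<open>Failure of the algorithm is the missing mass of an \<^typ>\<open>'a spmf\<close>.\<close>

primrec embed_list :: "'a set \<Rightarrow> 'b list \<Rightarrow> ('b, 'a) history \<Rightarrow> ('b, 'a) history spmf" where
  "embed_list A [] h = return_spmf h"
| "embed_list A (w # ws) h =
     bind_spmf (spmf_of_set (A - occupied h)) (\<lambda>y. embed_list A ws (h @ [(w, y)]))"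

definition embed_children ::
  "('a \<Rightarrow> 'a set) \<Rightarrow> (('b, 'a) history \<Rightarrow> 'b \<Rightarrow> 'b list) \<Rightarrow> 'b \<Rightarrow> ('b, 'a) history
     \<Rightarrow> ('b, 'a) history spmf" where
  "embed_children Np ord u h =
     (let A = Np (embedding_of h u); ws = ord h u
      in if length ws \<le> card (A - occupied h) then embed_list A ws h else return_pmf None)"

partial_function (spmf) algorithm2_loop ::
  "'b pair_pre_digraph \<Rightarrow> ('a \<Rightarrow> 'a set) \<Rightarrow> (('b, 'a) history \<Rightarrow> 'b)
     \<Rightarrow> (('b, 'a) history \<Rightarrow> 'b \<Rightarrow> 'b list) \<Rightarrow> ('b, 'a) history \<Rightarrow> ('b, 'a) history spmf" where
  "algorithm2_loop T Np pick ord h =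
     (if embedded h = pverts T then return_spmf h
      else bind_spmf (embed_children Np ord (pick h) h)
             (\<lambda>h'. algorithm2_loop T Np pick ord h'))"

definition algorithm2 ::
  "'b pair_pre_digraph \<Rightarrow> ('a \<Rightarrow> 'a set) \<Rightarrow> 'b \<Rightarrow> 'a \<Rightarrow> (('b, 'a) history \<Rightarrow> 'b)
     \<Rightarrow> (('b, 'a) history \<Rightarrow> 'b \<Rightarrow> 'b list) \<Rightarrow> ('b \<Rightarrow> 'a) spmf" where
  "algorithm2 T Np r x pick ord = map_spmf embedding_of (algorithm2_loop T Np pick ord [(r, x)])"

end

theory Submission
  imports Defs "HOL-Real_Asymp.Real_Asymp"
begin

text \<open>
  Write \<open>N v\<close> for the chosen neighbours of \<open>v\<close> and call \<open>|N v \<inter> N w|\<close> the codegree of \<open>v\<close> and \<open>w\<close>.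
  The algorithm can only fail at a vertex \<open>v\<close> with more than half of \<open>N v\<close> occupied. A child
  of a vertex placed at \<open>w\<close> hits \<open>N v\<close> with probability at most \<open>2 / d\<close> times the codegree of \<open>v\<close> and
  \<open>w\<close>, and \<open>w\<close> itself was drawn almost uniformly from some \<open>N w'\<close>. Since \<open>v\<close> is joined to all of \<open>N v\<close>,
  any \<open>t - 1\<close> further vertices have fewer than \<open>s\<close> common neighbours in \<open>N v\<close>, so by the
  Kovari--Sos--Turan argument the average codegree is of order \<open>d (s / d) powr (1 / (t - 1))\<close>. Hence only a small
  fraction of \<open>N v\<close> is occupied in expectation. Codegrees far above the average
  occur for few \<open>w\<close>, which lets an exponential moment of rate of order \<open>t ln d / d\<close> survive although the
  degrees in the tree may be linear in \<open>d\<close>.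

  As the order of the graph is not bounded in terms of \<open>d\<close>, there is no union bound over all \<open>v\<close>.
  Instead \<open>v\<close> is tracked only once \<open>N v\<close> meets the vertices that are occupied or
  chosen neighbours of an occupied vertex in at least \<open>t\<close> points: before that \<open>N v\<close> is
  harmless, and at most polynomially many \<open>v\<close> are ever tracked.
\<close>

section \<open>Rooted trees\<close>

context
  fixes T :: "'b pair_pre_digraph" and r :: 'b
  assumes tree: "tree_graph T" and root: "r \<in> pverts T"
begin

interpretation pair_graph T
  using tree by (simp add: tree_graph_def)

lemma no_long_cycle: "cycle p \<Longrightarrow> length p < 3"
  using tree unfolding tree_graph_def by (meson not_le)

lemma apath_from_root:
  assumes "v \<in> pverts T"
  obtains p where "apath r p v"
proof -
  \<comment> \<open>\<open>connected\<close> speaks of the symmetric closure, and a symmetric graph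
    is its own closure.\<close>
  have "parcs (mk_symmetric (with_proj T)) = parcs T" "pverts (mk_symmetric (with_proj T)) = pverts T"
    by (auto simp: mk_symmetric_def intro: arcs_symmetric)
  then have "mk_symmetric (with_proj T) = T" by simp
  then have "reachable (with_proj T) r v"
    using tree root assms unfolding tree_graph_def connected_def strongly_connected_def by simp
  then show ?thesis using that reachable_apath by auto
qed

lemma children_subset_neighbours: "children T r u \<subseteq> neighbours T u"
  by (auto simp: children_def neighbours_def apath_def awalk_simps)

lemma children_subset: "children T r u \<subseteq> pverts T"
  using children_subset_neighbours by (auto simp: neighbours_def dest: in_arcsD2)

lemma card_children_le_max_degree:
  assumes "u \<in> pverts T"
  shows "finite (children T r u)" "card (children T r u) \<le> max_degree T"
proof -
  have "neighbours T u = snd ` out_arcs (with_proj T) u"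
    by (force simp: neighbours_def out_arcs_def image_iff)
  moreover have fin: "finite (out_arcs (with_proj T) u)"
    using pair_finite_arcs by (rule finite_subset[rotated]) (auto simp: out_arcs_def)
  ultimately have fin': "finite (neighbours T u)"
    and "card (neighbours T u) \<le> out_degree (with_proj T) u"
    unfolding out_degree_def by (auto intro: card_image_le)
  moreover have "out_degree (with_proj T) u \<le> max_degree T"
    unfolding max_degree_def using assms by (intro Max_ge) auto
  ultimately show "card (children T r u) \<le> max_degree T"
    using card_mono[OF fin' children_subset_neighbours[of u]] by linarith
  show "finite (children T r u)"
    using children_subset_neighbours fin' by (rule finite_subset)
qed

lemma childE:
  assumes "w \<in> children T r u"
  obtains p where "apath r p u" "w \<notin> set (awalk_verts r p)"
    "apath r (p @ [(u, w)]) w" "(u, w) \<in> parcs T"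
proof -
  obtain p where p: "apath r (p @ [(u, w)]) w"
    using assms by (auto simp: children_def)
  then have "awalk r p u" "(u, w) \<in> parcs T"
    by (auto simp: apath_def awalk_simps)
  then have "awlast r p = u" by auto
  then show ?thesis using p \<open>(u, w) \<in> parcs T\<close> by (intro that[of p]) (auto simp: apath_append_iff)
qed

lemma root_not_child: "r \<notin> children T r u"
  by (metis awalk_hd_in_verts awhd_of_awalk childE awalk_verts_non_Nil hd_in_set awalkI_apath)

text \<open>The root paths of two parents, joined at the root and shortened, give a path between
  them that avoids \<open>w\<close>. Closing it through \<open>w\<close> gives a cycle with at least
  three arcs.\<close>

lemma parent_unique:
  assumes "w \<in> children T r u1" "w \<in> children T r u2"
  shows "u1 = u2"
proof (rule ccontr)
  assume "u1 \<noteq> u2"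
  obtain p1 where p1: "apath r p1 u1" "w \<notin> set (awalk_verts r p1)" "(u1, w) \<in> parcs T"
    using assms(1) by (elim childE)
  obtain p2 where p2: "apath r p2 u2" "w \<notin> set (awalk_verts r p2)" "(u2, w) \<in> parcs T"
    using assms(2) by (elim childE)
  define W where "W = rev_path p1 @ p2"
  have w1: "awalk u1 (rev_path p1) r" and w2: "awalk r p2 u2"
    using p1 p2 by (auto simp: apath_def)
  then have W: "awalk u1 W u2" unfolding W_def by (rule awalk_appendI)
  have "awalk_verts u1 (rev_path p1) = rev (awalk_verts r p1)"
    using p1 by (intro awalk_verts_rev_path) (auto simp: apath_def)
  then have wW: "w \<notin> set (awalk_verts u1 W)"
    unfolding W_def using set_awalk_verts_append[OF w1 w2] p1 p2 by auto
  define q where "q = awalk_to_apath W"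
  have q: "apath u1 q u2" unfolding q_def using W by (rule apath_awalk_to_apath)
  have "q \<noteq> []" using q \<open>u1 \<noteq> u2\<close> by (auto simp: apath_def awalk_simps)
  \<comment> \<open>Shortening keeps only arcs of \<open>W\<close>. As neither list is empty, the
    vertices are the endpoints of the arcs, so the path still avoids \<open>w\<close>.\<close>
  have qW: "set q \<subseteq> set W" unfolding q_def using W by (rule awalk_to_apath_subset)
  then have "W \<noteq> []" using \<open>q \<noteq> []\<close> by auto
  have "set (awalk_verts u1 W) = fst ` set W \<union> snd ` set W"
    by (simp add: set_awalk_verts_not_Nil[OF W \<open>W \<noteq> []\<close>])
  moreover have "set (awalk_verts u1 q) = fst ` set q \<union> snd ` set q"
    by (simp add: set_awalk_verts_not_Nil[OF awalkI_apath[OF q] \<open>q \<noteq> []\<close>])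
  ultimately have "set (awalk_verts u1 q) \<subseteq> set (awalk_verts u1 W)"
    using image_mono[OF qW, of fst] image_mono[OF qW, of snd] by (metis Un_mono)
  then have wq: "w \<notin> set (awalk_verts u1 q)"
    using wW by (rule contra_subsetD)
  have aw: "awalk u1 (q @ [(u2, w)]) w"
    using q p2 by (auto simp: apath_def awalk_simps dest: in_arcsD2)
  have "awalk_verts u1 (q @ [(u2, w)]) = awalk_verts u1 q @ [w]"
    using awalk_verts_append[OF aw] by simp
  then have "cycle ((w, u1) # q @ [(u2, w)])"
    using aw p1(3) q wq arcs_symmetric unfolding cycle_def
    by (intro exI[of _ w]) (auto simp: awalk_simps apath_def dest: in_arcsD2)
  from no_long_cycle[OF this] \<open>q \<noteq> []\<close> show False by (cases q) auto
qed

lemma parent_exists: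
  assumes "w \<in> pverts T" "w \<noteq> r"
  shows "\<exists>u. w \<in> children T r u"
proof -
  obtain p where p: "apath r p w" using assms(1) by (rule apath_from_root)
  then have "p \<noteq> []" using assms(2) by (auto simp: apath_def awalk_simps)
  then obtain q u v where "p = q @ [(u, v)]" by (metis rev_exhaust surj_pair)
  then show ?thesis using p by (auto simp: children_def apath_def awalk_simps)
qed

text \<open>If \<open>w\<close> is not on the root path of \<open>u\<close>, the arc extends this
  path. Otherwise the arc closes the stretch from \<open>w\<close> to \<open>u\<close> to a cycle;
  this has length 2, so the stretch is the single arc \<open>(w, u)\<close>.\<close>

lemma arc_child:
  assumes "(u, w) \<in> parcs T"
  shows "w \<in> children T r u \<or> u \<in> children T r w"
proof -
  obtain p where p: "apath r p u" using in_arcsD1[OF assms] by (rule apath_from_root)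
  show ?thesis
  proof (cases "w \<in> set (awalk_verts r p)")
    case False
    have "awlast r p = u" using p by (auto simp: apath_def)
    then have "apath r (p @ [(u, w)]) w"
      using p False assms no_loops' by (auto simp: apath_append_iff apath_simps dest: in_arcsD2)
    then show ?thesis by (auto simp: children_def)
  next
    case True
    then obtain p1 p2 where d: "p = p1 @ p2" "awalk r p1 w" "awalk w p2 u"
      using awalk_decomp p by (metis apath_def)
    then have l: "awlast r p1 = w" by auto
    have p2: "apath w p2 u" using p d l by (auto simp: apath_append_iff)
    have "cycle ((u, w) # p2)" unfolding cycle_def using p2 assms
      by (intro exI[of _ u]) (auto simp: awalk_simps apath_def dest: in_arcsD1)
    from no_long_cycle[OF this] have "length p2 < 2" by simp
    moreover have "p2 \<noteq> []" using d(3) no_loops'[OF assms] by (auto simp: awalk_simps)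
    ultimately obtain e where "p2 = [e]" by (cases p2) auto
    then have "p2 = [(w, u)]" using d(3) by (cases e) (auto simp: awalk_simps)
    then show ?thesis using p d by (auto simp: children_def)
  qed
qed

text \<open>Induction along root paths. The loop uses this to see that a vertex can be picked as
  long as \<open>T\<close> is not completely embedded.\<close>

lemma children_closed_eq_verts:
  assumes "E \<subseteq> pverts T" "r \<in> E" "\<And>u. u \<in> E \<Longrightarrow> children T r u \<subseteq> E"
  shows "E = pverts T"
proof -
  have "apath r p v \<Longrightarrow> v \<in> E" for p v
  proof (induction p arbitrary: v rule: rev_induct)
    case Nil
    then show ?case using assms(2) by (auto simp: apath_def awalk_simps)
  next
    case (snoc e p)
    then obtain u where e: "e = (u, v)" by (cases e) (auto simp: apath_def awalk_simps)
    then have "v \<in> children T r u" using snoc.prems by (auto simp: children_def)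
    then show ?case using assms(3) snoc.IH snoc.prems e
      by (metis apath_append_iff awalkI_apath awalk_Cons_iff awalk_append_iff awlast_of_awalk fst_conv subsetD)
  qed
  then show ?thesis using assms(1) apath_from_root by (metis subsetI subset_antisym)
qed

end

section \<open>Counting in graphs without a complete bipartite subgraph\<close>

text \<open>The right side is a falling factorial, whose \<open>j\<close> factors are all at least
  \<open>n - (j - 1)\<close>. For \<open>n < j\<close> truncated subtraction makes the left side
  \<open>0\<close>, since \<open>j\<close> is positive.\<close>

lemma pow_le_fact_times_binomial:
  "(n - (j - 1)) ^ j \<le> fact j * (n choose j)" if "j \<ge> 1" for n j :: nat
proof (cases "n < j")
  case True
  then show ?thesis using that by (simp add: power_0_left)
next
  case False
  have *: "x ^ Suc k \<le> fact (Suc k) * ((x + k) choose Suc k)" for x k :: nat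
  proof (induction k)
    case (Suc k)
    have "x ^ Suc (Suc k) \<le> (x + Suc k) * (fact (Suc k) * ((x + k) choose Suc k))"
      using mult_le_mono[OF _ Suc, of x "x + Suc k"] by simp
    also have "\<dots> = fact (Suc k) * (Suc (Suc k) * (Suc (x + k) choose Suc (Suc k)))"
      by (subst Suc_times_binomial) (simp add: algebra_simps)
    finally show ?case by (simp add: algebra_simps)
  qed simp
  show ?thesis using *[of "n - (j - 1)" "j - 1"] that False by simp
qed

text \<open>Double counting of the pairs of an element \<open>b\<close> and a
  \<open>j\<close>-subset of \<open>A\<close> all of whose elements are related to
  \<open>b\<close>.\<close>

lemma sum_binomial_degree:
  assumes "finite A" "finite B"
  shows "(\<Sum>b\<in>B. card {a \<in> A. R a b} choose j)
    = (\<Sum>J | J \<subseteq> A \<and> card J = j. card {b \<in> B. \<forall>a\<in>J. R a b})"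
proof -
  have fin: "finite {J. J \<subseteq> A \<and> card J = j}" using assms(1) by simp
  have "(\<Sum>b\<in>B. card {a \<in> A. R a b} choose j)
      = (\<Sum>b\<in>B. card {J \<in> {J. J \<subseteq> A \<and> card J = j}. \<forall>a\<in>J. R a b})"
  proof (rule sum.cong)
    fix b
    have "{J \<in> {J. J \<subseteq> A \<and> card J = j}. \<forall>a\<in>J. R a b} = {J. J \<subseteq> {a \<in> A. R a b} \<and> card J = j}"
      by auto
    then show "(card {a \<in> A. R a b} choose j)
        = card {J \<in> {J. J \<subseteq> A \<and> card J = j}. \<forall>a\<in>J. R a b}"
      using n_subsets[of "{a \<in> A. R a b}" j] assms(1) by simp
  qed simp
  also have "\<dots> = (\<Sum>b\<in>B. \<Sum>J | J \<in> {J. J \<subseteq> A \<and> card J = j} \<and> (\<forall>a\<in>J. R a b). 1)"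
    by simp
  also have "\<dots> = (\<Sum>J\<in>{J. J \<subseteq> A \<and> card J = j}. \<Sum>b | b \<in> B \<and> (\<forall>a\<in>J. R a b). 1)"
    by (rule sum.swap_restrict[OF assms(2) fin])
  finally show ?thesis by simp
qed

text \<open>At density \<open>\<rho>\<close>, \<open>j\<close> elements of \<open>A\<close> would
  have \<open>s\<close> common neighbours in a random bipartite graph on average. The factor 2 is
  the price of using \<open>tangent\<close> in place of convexity; the summand
  \<open>(j - 1) * d\<close> pays for passing from binomial coefficients to powers.\<close>

lemma bipartite_edge_bound:
  fixes \<rho> :: real
  assumes "finite A" "finite B" "card B = d" "j \<ge> 1" "s \<ge> 1"
    and few: "\<And>J. J \<subseteq> A \<Longrightarrow> card J = j \<Longrightarrow> card {b \<in> B. \<forall>a\<in>J. R a b} \<le> s"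
    and \<rho>: "\<rho> > 0" "real d * \<rho> ^ j = real s"
  shows "real (\<Sum>a\<in>A. card {b \<in> B. R a b}) \<le> 2 * real (card A) * d * \<rho> + real (j - 1) * d"
proof (cases "A = {}")
  case False
  define n where "n = card A"
  have n: "n > 0" using False assms(1) by (simp add: n_def card_gt_0_iff)
  define deg where "deg b = card {a \<in> A. R a b}" for b
  define x where "x b = deg b - (j - 1)" for b
  have "(\<Sum>b\<in>B. x b ^ j) \<le> (\<Sum>b\<in>B. fact j * (deg b choose j))"
    unfolding x_def by (intro sum_mono pow_le_fact_times_binomial assms)
  also have "\<dots> = fact j * (\<Sum>J | J \<subseteq> A \<and> card J = j. card {b \<in> B. \<forall>a\<in>J. R a b})"
    unfolding deg_def sum_binomial_degree[OF assms(1,2), symmetric] by (simp add: sum_distrib_left)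
  also have "\<dots> \<le> fact j * (\<Sum>J | J \<subseteq> A \<and> card J = j. s)"
    by (intro mult_left_mono sum_mono few) auto
  also have "\<dots> = (fact j * (n choose j)) * s"
    using n_subsets[OF assms(1)] by (simp add: n_def)
  also have "\<dots> \<le> n ^ j * s"
    using binomial_fact_pow[of n j] by (intro mult_right_mono) (simp_all add: mult.commute)
  finally have pow: "(\<Sum>b\<in>B. real (x b) ^ j) \<le> real n ^ j * real s"
    by (metis (mono_tags, lifting) of_nat_le_iff of_nat_mult of_nat_power of_nat_sum sum.cong)
  \<comment> \<open>The mean degree into \<open>A\<close> at density \<open>\<rho>\<close>. With
    this choice each of the two summands of \<open>tangent\<close>, summed over \<open>B\<close>,
    contributes at most \<open>c * d\<close>.\<close>
  define c where "c = real n * \<rho>"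
  have c: "c > 0" using n \<rho> by (simp add: c_def)
  have tangent: "real m \<le> c + real m ^ j / c ^ (j - 1)" for m
  proof (cases "real m \<le> c")
    case False
    then have "real m * c ^ (j - 1) \<le> real m * real m ^ (j - 1)"
      using c by (intro mult_left_mono power_mono) auto
    then have "real m \<le> real m ^ j / c ^ (j - 1)"
      using c \<open>j \<ge> 1\<close> by (simp add: pos_le_divide_eq flip: power_Suc)
    then show ?thesis using c by linarith
  qed (use c in \<open>simp add: add_increasing2\<close>)
  have "real (\<Sum>a\<in>A. card {b \<in> B. R a b}) = (\<Sum>b\<in>B. real (deg b))"
    using sum.swap_restrict[OF assms(1,2), of "\<lambda>_ _. 1::nat" R] by (simp add: deg_def)
  also have "\<dots> \<le> (\<Sum>b\<in>B. real (j - 1) + (c + real (x b) ^ j / c ^ (j - 1)))"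
  proof (rule sum_mono)
    fix b
    have "real (deg b) \<le> real (j - 1) + real (x b)" unfolding x_def by linarith
    then show "real (deg b) \<le> real (j - 1) + (c + real (x b) ^ j / c ^ (j - 1))"
      using tangent[of "x b"] by linarith
  qed
  also have "\<dots> = real (j - 1) * d + c * d + (\<Sum>b\<in>B. real (x b) ^ j) / c ^ (j - 1)"
    using \<open>card B = d\<close> by (simp add: sum.distrib sum_divide_distrib algebra_simps)
  also have "\<dots> \<le> real (j - 1) * d + c * d + real n ^ j * real s / c ^ (j - 1)"
    using pow c by (intro add_left_mono divide_right_mono) auto
  also have "real n ^ j * real s / c ^ (j - 1) = c * d"
  proof -
    have "real n ^ j * real s = c ^ j * d" unfolding c_def power_mult_distrib \<rho>(2)[symmetric] by simp
    also have "c ^ j = c * c ^ (j - 1)" using \<open>j \<ge> 1\<close> by (simp flip: power_Suc)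
    finally show ?thesis using c by simp
  qed
  finally show ?thesis by (simp add: c_def n_def algebra_simps)
qed simp

text \<open>Union bound over the \<open>t\<close>-subsets of \<open>Z\<close>: each vertex counted
  has one of them inside \<open>N v\<close>, and each of them lies in at most \<open>s\<close> sets
  \<open>N v\<close>.\<close>

lemma card_many_neighbours_le:
  fixes N :: "'a \<Rightarrow> 'a set"
  assumes "finite V" "finite Z"
    and few: "\<And>J. card J = t \<Longrightarrow> card {v \<in> V. J \<subseteq> N v} \<le> s"
  shows "card {v \<in> V. t \<le> card (N v \<inter> Z)} \<le> s * card Z ^ t"
proof -
  have "{v \<in> V. t \<le> card (N v \<inter> Z)} \<subseteq> (\<Union>J\<in>{J. J \<subseteq> Z \<and> card J = t}. {v \<in> V. J \<subseteq> N v})"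
  proof clarsimp
    fix v assume "v \<in> V" "t \<le> card (N v \<inter> Z)"
    then obtain J where "J \<subseteq> N v \<inter> Z" "card J = t" by (rule_tac obtain_subset_with_card_n)
    then show "\<exists>J. J \<subseteq> Z \<and> card J = t \<and> J \<subseteq> N v" by auto
  qed
  then have "card {v \<in> V. t \<le> card (N v \<inter> Z)}
      \<le> card (\<Union>J\<in>{J. J \<subseteq> Z \<and> card J = t}. {v \<in> V. J \<subseteq> N v})"
    using assms by (intro card_mono) auto
  also have "\<dots> \<le> (\<Sum>J\<in>{J. J \<subseteq> Z \<and> card J = t}. card {v \<in> V. J \<subseteq> N v})"
    using assms(2) by (intro card_UN_le) auto
  also have "\<dots> \<le> (\<Sum>J\<in>{J. J \<subseteq> Z \<and> card J = t}. s)"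
    by (intro sum_mono few) auto
  also have "\<dots> = s * (card Z choose t)" using n_subsets[OF assms(2)] by simp
  also have "\<dots> \<le> s * card Z ^ t"
    using binomial_fact_pow[of "card Z" t]
    by (intro mult_left_mono) (metis (no_types) fact_ge_1 mult_le_mono2 nat_mult_1_right order_trans, simp)
  finally show ?thesis .
qed

text \<open>Any \<open>s\<close> elements of \<open>C\<close> span the forbidden subgraph together
  with \<open>S\<close>; the two parts are disjoint because \<open>G\<close> has no loops.\<close>

lemma Kst_free_few_common:
  assumes G: "pair_graph G" "Kst_free s t G"
    and "S \<subseteq> pverts G" "card S = t" "t > 0" "C \<times> S \<subseteq> parcs G"
  shows "card C < s"
proof (rule ccontr)
  interpret pair_graph G by fact
  assume "\<not> card C < s"
  then obtain C' where C': "C' \<subseteq> C" "card C' = s" "finite C'"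
    by (meson not_less obtain_subset_with_card_n)
  have "finite S" using assms(4,5) card_ge_0_finite by blast
  define H where "H = \<lparr>pverts = C' \<union> S, parcs = C' \<times> S \<union> S \<times> C'\<rparr>"
  have sub: "C' \<times> S \<subseteq> parcs G" using C' assms(6) by auto
  have "S \<noteq> {}" using assms(4,5) by auto
  then have "pverts H \<subseteq> pverts G"
    using assms(3) sub by (auto simp: H_def dest: in_arcsD1)
  moreover have "parcs H \<subseteq> parcs G"
    using sub by (auto simp: H_def intro: arcs_symmetric)
  moreover have "C' \<inter> S = {}" using sub no_loops' by blast
  then have K: "complete_bipartite_digraph s t (with_proj H)"
    using C' \<open>finite S\<close> assms(4) unfolding complete_bipartite_digraph_pair_def
    by (auto simp: H_def)
  moreover have "wf_digraph (with_proj H)"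
    using pair_graphI_complete_bipartite[OF K] by (simp add: wf_digraph_wp_iff pair_graph_def pair_digraph_def pair_fin_digraph_def)
  ultimately have "subgraph (with_proj H) (with_proj G)"
    by (auto simp: subgraph_def compatible_def wf_digraph_axioms)
  then show False using K G(2) unfolding Kst_free_def by blast
qed

section \<open>The potential of a partial embedding\<close>

text \<open>
  At most \<open>h\<close> elements of any \<open>N w\<close> have codegree above \<open>k\<close> with \<open>v\<close>. Embedding \<open>y\<close> costs a
  factor \<open>exp (b0 + b1 c)\<close> in the weights below, \<open>c\<close> being the number of children of \<open>y\<close>: \<open>b0\<close> pays
  for a hit at a vertex of large codegree and \<open>b1\<close> for the hits to be expected from these children.
\<close>

locale tree_process =
  fixes V :: "'a set" and N :: "'a \<Rightarrow> 'a set" and VT :: "'b set" and r :: 'b and par :: "'b \<Rightarrow> 'b"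
    and d t M \<Delta> :: nat and \<theta> \<mu> b0 b1 k h S1 :: real
  assumes fin_V: "finite V" and N_subset: "v \<in> V \<Longrightarrow> N v \<subseteq> V" and card_N: "v \<in> V \<Longrightarrow> card (N v) = d"
    and fin_VT: "finite VT" and root_VT: "r \<in> VT"
    and card_ch: "card {y \<in> VT. y \<noteq> r \<and> par y = u} \<le> \<Delta>"
    and t_pos: "t \<ge> 1" and t_le: "2 * t \<le> d"
    and card_dense: "Z \<subseteq> V \<Longrightarrow> card Z \<le> card VT * (d + 1) \<Longrightarrow> card {v \<in> V. t \<le> card (N v \<inter> Z)} \<le> M"
    and sum_codeg: "v \<in> V \<Longrightarrow> w \<in> V
      \<Longrightarrow> (\<Sum>z\<in>N w. if v = z then 0 else real (card (N v \<inter> N z))) \<le> S1"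
    and card_heavy: "v \<in> V \<Longrightarrow> w \<in> V
      \<Longrightarrow> real (card {z \<in> N w. v \<noteq> z \<and> k < real (card (N v \<inter> N z))}) \<le> h"
    and nonneg: "\<theta> \<ge> 0" "\<mu> \<ge> 0" "b0 \<ge> 0" "b1 \<ge> 0" "k \<ge> 0"
    and \<mu>_ge: "2 / d * ((exp \<theta> - 1) * exp (\<mu> * \<Delta> * k)) \<le> \<mu>"
    and b0_ge: "2 / d * ((exp \<theta> - 1) * (h * exp (\<mu> * \<Delta> * d))) \<le> b0"
    and b1_ge: "2 / d * (\<mu> * (exp (\<mu> * \<Delta> * k) * S1 + h * d * exp (\<mu> * \<Delta> * d))) \<le> b1"
begin

lemma d_pos: "d > 0" using t_pos t_le by linarith

lemma fin_N: "v \<in> V \<Longrightarrow> finite (N v)"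
  using N_subset fin_V finite_subset by blast

definition ch :: "'b \<Rightarrow> 'b set" where
  "ch u = {y \<in> VT. y \<noteq> r \<and> par y = u}"

definition codeg :: "'a \<Rightarrow> 'a \<Rightarrow> real" where
  "codeg v w = (if v = w then 0 else real (card (N v \<inter> N w)))"

text \<open>
  The children of a vertex placed at \<open>v\<close> itself are not counted: there are at most \<open>\<Delta>\<close> of them, and
  counting them would make the codegree of \<open>v\<close> with itself relevant.
\<close>

definition hits :: "'a \<Rightarrow> 'b set \<Rightarrow> ('b \<Rightarrow> 'a) \<Rightarrow> nat" where
  "hits v E f = card {y \<in> E. y \<noteq> r \<and> f y \<in> N v \<and> f (par y) \<noteq> v}"

text \<open>
  Up to a factor close to \<open>2 / d\<close>, the expected number of hits by vertices whose parent is already placed.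
\<close>

definition pending :: "'a \<Rightarrow> 'b set \<Rightarrow> ('b \<Rightarrow> 'a) \<Rightarrow> real" where
  "pending v E f = (\<Sum>y\<in>VT - E. if par y \<in> E then codeg v (f (par y)) else 0)"

text \<open>The cost of all vertices still to be embedded is carried in advance; embedding
  \<open>y\<close> releases its summand, which offsets part of the expected growth of
  \<open>weight\<close>.\<close>

definition budget :: "'b set \<Rightarrow> real" where
  "budget E = (\<Sum>y\<in>VT - E. b0 + b1 * real (card (ch y)))"

definition weight :: "'a \<Rightarrow> 'b set \<Rightarrow> ('b \<Rightarrow> 'a) \<Rightarrow> real" where
  "weight v E f = exp (\<theta> * real (hits v E f) + \<mu> * pending v E f + budget E)"

text \<open>Chosen neighbours are included besides images, so that for a vertex \<open>v\<close>
  outside \<open>active\<close> both the occupied points of \<open>N v\<close> and every codegree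
  with an occupied vertex stay below \<open>t\<close>.\<close>

definition reach :: "'b set \<Rightarrow> ('b \<Rightarrow> 'a) \<Rightarrow> 'a set" where
  "reach E f = f ` E \<union> \<Union> (N ` f ` E)"

definition active :: "'b set \<Rightarrow> ('b \<Rightarrow> 'a) \<Rightarrow> 'a set" where
  "active E f = {v \<in> V. t \<le> card (N v \<inter> reach E f)}"

text \<open>The largest weight that a vertex can have at the moment it becomes active.\<close>

definition entry :: real where
  "entry = exp (\<theta> * t + \<mu> * (real (t - 1) * card VT + real \<Delta> * d) + (b0 + b1) * card VT)"

text \<open>
  Each of the at most \<open>M\<close> vertices that may become active is charged \<open>entry\<close> in advance, so newly
  active vertices do not increase the potential.
\<close>

definition potential :: "'b set \<Rightarrow> ('b \<Rightarrow> 'a) \<Rightarrow> real" where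
  "potential E f = (\<Sum>v\<in>active E f. weight v E f) + (real M - real (card (active E f))) * entry"

definition state :: "'b set \<Rightarrow> ('b \<Rightarrow> 'a) \<Rightarrow> bool" where
  "state E f \<longleftrightarrow> E \<subseteq> VT \<and> r \<in> E \<and> f ` E \<subseteq> V \<and> inj_on f E \<and> (\<forall>y\<in>E. y \<noteq> r \<longrightarrow> par y \<in> E)"

lemma codeg_nonneg: "codeg v w \<ge> 0"
  by (simp add: codeg_def)

lemma codeg_le: "v \<in> V \<Longrightarrow> codeg v w \<le> d"
  using card_mono[OF fin_N, of v "N v \<inter> N w"] by (auto simp: codeg_def card_N)

lemma fin_ch: "finite (ch u)"
  using fin_VT by (simp add: ch_def)

lemma card_ch_le: "card (ch u) \<le> \<Delta>"
  using card_ch by (simp add: ch_def)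

lemma stateD:
  assumes "state E f"
  shows "finite E" "E \<subseteq> VT" "r \<in> E" "f ` E \<subseteq> V" "inj_on f E"
    "\<And>y. y \<in> E \<Longrightarrow> y \<noteq> r \<Longrightarrow> par y \<in> E"
  using assms fin_VT finite_subset by (auto simp: state_def)

lemma state_insert:
  assumes "state E f" "y \<in> VT - E" "par y \<in> E" "z \<in> V" "z \<notin> f ` E"
  shows "state (insert y E) (f(y := z))"
  using assms unfolding state_def by (auto simp: inj_on_def image_iff split: if_splits)

lemma sum_card_ch_le:
  assumes "U \<subseteq> VT"
  shows "(\<Sum>y\<in>U. card (ch y)) \<le> card VT"
proof -
  have fin: "finite U" using assms fin_VT finite_subset by blast
  have "(\<Sum>y\<in>U. card (ch y)) = card (\<Union> (ch ` U))"
    using fin fin_ch by (intro card_UN_disjoint[symmetric]) (auto simp: ch_def)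
  also have "\<dots> \<le> card VT" using fin_VT by (intro card_mono) (auto simp: ch_def)
  finally show ?thesis .
qed

lemma budget_bounds: "0 \<le> budget E" "budget E \<le> (b0 + b1) * card VT"
proof -
  show "0 \<le> budget E" unfolding budget_def using nonneg by (intro sum_nonneg) auto
  have "budget E = b0 * card (VT - E) + b1 * (\<Sum>y\<in>VT - E. card (ch y))"
    by (simp add: budget_def sum.distrib sum_distrib_left)
  also have "\<dots> \<le> b0 * card VT + b1 * card VT"
    using nonneg fin_VT sum_card_ch_le[of "VT - E"]
    by (intro add_mono mult_left_mono) (auto intro: card_mono simp del: of_nat_sum)
  finally show "budget E \<le> (b0 + b1) * card VT" by (simp add: algebra_simps)
qed

lemma pending_nonneg: "0 \<le> pending v E f"
  unfolding pending_def by (intro sum_nonneg) (auto simp: codeg_nonneg)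

section \<open>The effect of embedding one vertex\<close>

context
  fixes E :: "'b set" and f :: "'b \<Rightarrow> 'a" and y :: 'b
  assumes st: "state E f" and y: "y \<in> VT - E" "par y \<in> E"
begin

lemma y_neq: "y \<noteq> r" "par y \<noteq> y"
  using st y by (auto dest: stateD)

lemma par_neq: "y' \<in> E \<Longrightarrow> y' \<noteq> r \<Longrightarrow> par y' \<noteq> y"
  using stateD(6)[OF st] y by auto

lemma hits_insert:
  "hits v (insert y E) (f(y := z)) = hits v E f + of_bool (z \<in> N v \<and> f (par y) \<noteq> v)"
proof -
  let ?A = "\<lambda>E f. {y \<in> E. y \<noteq> r \<and> f y \<in> N v \<and> f (par y) \<noteq> v}"
  have "?A (insert y E) (f(y := z)) = ?A E f \<union> (if z \<in> N v \<and> f (par y) \<noteq> v then {y} else {})"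
    using y_neq par_neq y by auto
  moreover have "finite (?A E f)" using stateD(1)[OF st] by auto
  moreover have "y \<notin> ?A E f" using y by blast
  ultimately show ?thesis unfolding hits_def by (simp del: mem_Collect_eq)
qed

text \<open>\<open>y\<close> itself stops being pending and its children start. None of them is
  embedded yet, since \<open>E\<close> contains the parents of its elements other than the
  root.\<close>

lemma pending_insert:
  "pending v (insert y E) (f(y := z))
    = pending v E f - codeg v (f (par y)) + card (ch y) * codeg v z"
proof -
  let ?g = "\<lambda>y'. if par y' \<in> E then codeg v (f (par y')) else 0"
  let ?R = "VT - E - {y}"
  have fin: "finite (VT - E)" "finite ?R" using fin_VT by auto
  have "pending v (insert y E) (f(y := z)) = (\<Sum>y'\<in>?R. ?g y' + (if par y' = y then codeg v z else 0))"
    unfolding pending_def using y by (intro sum.cong) auto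
  also have "\<dots> = (\<Sum>y'\<in>?R. ?g y') + (\<Sum>y' | y' \<in> ?R \<and> par y' = y. codeg v z)"
    unfolding sum.inter_filter[OF fin(2)] by (rule sum.distrib)
  also have "(\<Sum>y'\<in>?R. ?g y') = pending v E f - codeg v (f (par y))"
    using sum.remove[OF fin(1), of y ?g] y by (simp add: pending_def)
  also have "{y' \<in> ?R. par y' = y} = ch y"
    using y_neq par_neq stateD(3)[OF st] by (auto simp: ch_def)
  finally show ?thesis by (simp only: sum_constant)
qed

lemma budget_insert: "budget (insert y E) = budget E - (b0 + b1 * card (ch y))"
proof -
  have "VT - insert y E = VT - E - {y}" by auto
  then show ?thesis
    using sum.remove[of "VT - E" y "\<lambda>y. b0 + b1 * real (card (ch y))"] y fin_VT
    by (simp add: budget_def)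
qed

text \<open>The mean over all of \<open>N w\<close> is at most half of the exponent released by
  embedding \<open>y\<close>. The spare factor 2 allows half of \<open>N w\<close> to be
  occupied.\<close>

lemma sum_exp_increment_le:
  assumes v: "v \<in> V" and w: "w \<in> V" and c: "c \<le> \<Delta>"
  shows "(\<Sum>z\<in>N w. exp (\<theta> * of_bool (z \<in> N v \<and> w \<noteq> v) + \<mu> * (real c * codeg v z)) - 1)
    \<le> d / 2 * (\<mu> * codeg v w + (b0 + b1 * c))"
proof -
  define hit where "hit z = (of_bool (z \<in> N v \<and> w \<noteq> v) :: real)" for z :: 'a
  define heavy where "heavy z = (of_bool (v \<noteq> z \<and> k < real (card (N v \<inter> N z))) :: real)" for z
  define L where "L = exp (\<mu> * \<Delta> * k)"
  define B where "B = exp (\<mu> * \<Delta> * d)"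
  have count: "(\<Sum>z\<in>N w. of_bool (Q z)) = real (card {z \<in> N w. Q z})" for Q :: "'a \<Rightarrow> bool"
    unfolding of_bool_def sum.inter_filter[OF fin_N[OF w], symmetric] by simp
  have heavy: "(\<Sum>z\<in>N w. heavy z) \<le> h"
    using card_heavy[OF v w] unfolding heavy_def count .
  have "N v \<inter> N w = {z \<in> N w. z \<in> N v}" by auto
  \<comment> \<open>For \<open>w = v\<close> both sides vanish: \<open>hits\<close> ignores children
    of a vertex placed at \<open>v\<close>, and \<open>codeg v v\<close> is \<open>0\<close> by
    convention.\<close>
  then have hit: "(\<Sum>z\<in>N w. hit z) = codeg v w"
    unfolding hit_def count codeg_def by auto
  have S1: "(\<Sum>z\<in>N w. codeg v z) \<le> S1"
    using sum_codeg[OF v w] by (simp add: codeg_def)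
  \<comment> \<open>A light point has codegree at most \<open>k\<close>, any point at most
    \<open>d\<close>. The large bound \<open>B\<close> is affordable because at most
    \<open>h\<close> points are heavy.\<close>
  have exp_le: "exp (\<mu> * (real c * codeg v z)) \<le> L + heavy z * B" for z
  proof (cases "heavy z = 0")
    case True
    then have "codeg v z \<le> k" using nonneg by (auto simp: heavy_def codeg_def)
    then have "real c * codeg v z \<le> real \<Delta> * k"
      using c by (intro mult_mono) (auto simp: codeg_nonneg)
    then have "\<mu> * (real c * codeg v z) \<le> \<mu> * \<Delta> * k"
      using nonneg by (simp add: mult_left_mono mult.assoc)
    then show ?thesis using True by (simp add: L_def)
  next
    case False
    have "real c * codeg v z \<le> real \<Delta> * d"
      using c codeg_le[OF v] by (intro mult_mono) (auto simp: codeg_nonneg)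
    then have "\<mu> * (real c * codeg v z) \<le> \<mu> * \<Delta> * d"
      using nonneg by (simp add: mult_left_mono mult.assoc)
    then have "exp (\<mu> * (real c * codeg v z)) \<le> B" by (simp add: B_def)
    then show ?thesis using False by (simp add: heavy_def L_def add_increasing)
  qed
  have L0: "L \<ge> 0" and B0: "B \<ge> 0" by (simp_all add: L_def B_def)
  have hit01: "0 \<le> hit z" "hit z \<le> 1" and heavy01: "0 \<le> heavy z" for z
    by (auto simp: hit_def heavy_def)
  have e1: "exp \<theta> - 1 \<ge> 0" using nonneg by simp
  have "exp (\<theta> * hit z + \<mu> * (real c * codeg v z)) - 1
      \<le> (exp \<theta> - 1) * (hit z * L + heavy z * B)
        + \<mu> * c * (codeg v z * L + heavy z * (d * B))" for z
  proof -
    define b where "b = \<mu> * (real c * codeg v z)"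
    have b0: "b \<ge> 0" using nonneg codeg_nonneg by (simp add: b_def)
    \<comment> \<open>As \<open>hit z\<close> is \<open>0\<close> or \<open>1\<close>, the
      exponential is affine in it, and the increment splits into a part for the hit and a part for
      the new pending children.\<close>
    have "exp (\<theta> * hit z) = 1 + hit z * (exp \<theta> - 1)" by (simp add: hit_def)
    then have "exp (\<theta> * hit z + b) = (1 + hit z * (exp \<theta> - 1)) * exp b"
      by (simp only: exp_add)
    then have "exp (\<theta> * hit z + b) - 1 = (exp \<theta> - 1) * (hit z * exp b) + (exp b - 1)"
      by (simp only: algebra_simps)
    moreover have "hit z * exp b \<le> hit z * L + heavy z * B"
    proof -
      have "hit z * exp b \<le> hit z * (L + heavy z * B)"
        using exp_le[of z] hit01 by (intro mult_left_mono) (auto simp: b_def)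
      moreover have "hit z * (heavy z * B) \<le> heavy z * B"
        using hit01 heavy01 B0 by (intro mult_left_le_one_le) auto
      ultimately show ?thesis by (simp add: algebra_simps)
    qed
    then have "(exp \<theta> - 1) * (hit z * exp b) \<le> (exp \<theta> - 1) * (hit z * L + heavy z * B)"
      using e1 by (rule mult_left_mono)
    moreover have "exp b - 1 \<le> b * exp b"
      using exp_ge_add_one_self[of "- b"] mult_right_mono[of "1 - b" "exp (- b)" "exp b"]
      by (simp add: algebra_simps flip: exp_add)
    moreover have "b * exp b \<le> b * (L + heavy z * B)"
      using exp_le[of z] b0 by (intro mult_left_mono) (auto simp: b_def)
    moreover have "b * (L + heavy z * B) \<le> \<mu> * c * (codeg v z * L + heavy z * (d * B))"
    proof -
      have "codeg v z * (heavy z * B) \<le> d * (heavy z * B)"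
        using codeg_le[OF v] heavy01 B0 by (intro mult_right_mono) auto
      then have "codeg v z * (L + heavy z * B) \<le> codeg v z * L + heavy z * (d * B)"
        by (simp add: algebra_simps)
      then have "\<mu> * c * (codeg v z * (L + heavy z * B)) \<le> \<mu> * c * (codeg v z * L + heavy z * (d * B))"
        using nonneg by (intro mult_left_mono) auto
      then show ?thesis by (simp add: b_def mult_ac)
    qed
    ultimately show ?thesis unfolding b_def by linarith
  qed
  then have "(\<Sum>z\<in>N w. exp (\<theta> * hit z + \<mu> * (real c * codeg v z)) - 1)
      \<le> (\<Sum>z\<in>N w. (exp \<theta> - 1) * (hit z * L + heavy z * B)
        + \<mu> * c * (codeg v z * L + heavy z * (d * B)))"
    by (intro sum_mono)
  also have "\<dots> = (exp \<theta> - 1) * ((\<Sum>z\<in>N w. hit z) * L + (\<Sum>z\<in>N w. heavy z) * B)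
      + \<mu> * c * ((\<Sum>z\<in>N w. codeg v z) * L + (\<Sum>z\<in>N w. heavy z) * (d * B))"
    by (simp add: sum.distrib flip: sum_distrib_left sum_distrib_right)
  also have "\<dots> \<le> (exp \<theta> - 1) * (codeg v w * L + h * B) + \<mu> * c * (S1 * L + h * (d * B))"
    using hit heavy S1 L0 B0 e1 nonneg
    by (intro add_mono mult_left_mono mult_right_mono) auto
  also have "\<dots> = codeg v w * ((exp \<theta> - 1) * L) + (exp \<theta> - 1) * (h * B)
      + c * (\<mu> * (L * S1 + h * d * B))"
    by (simp add: algebra_simps)
  \<comment> \<open>The three summands are what \<open>\<mu>_ge\<close>, \<open>b0_ge\<close> and
    \<open>b1_ge\<close> control.\<close>
  also have "\<dots> \<le> codeg v w * (d / 2 * \<mu>) + d / 2 * b0 + c * (d / 2 * b1)"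
    using \<mu>_ge b0_ge b1_ge d_pos codeg_nonneg
    by (intro add_mono mult_left_mono) (auto simp: L_def B_def field_simps)
  finally show ?thesis by (simp add: hit_def algebra_simps)
qed

text \<open>\<open>pending\<close> and \<open>budget\<close> together release the exponent
  \<open>x\<close>, while the mean growth factor over \<open>S\<close> is at most
  \<open>1 + x \<le> exp x\<close>. Increments are nonnegative, so the sum over \<open>S\<close> is
  bounded by the one over \<open>N w\<close>.\<close>

lemma weight_supermartingale:
  assumes v: "v \<in> V" and S: "S \<subseteq> N (f (par y))" "d \<le> 2 * card S"
  shows "(\<Sum>z\<in>S. weight v (insert y E) (f(y := z))) \<le> card S * weight v E f"
proof -
  define w where "w = f (par y)"
  define c where "c = card (ch y)"
  have w: "w \<in> V" using stateD(4)[OF st] y by (auto simp: w_def)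
  define x where "x = \<mu> * codeg v w + (b0 + b1 * c)"
  define g where "g z = exp (\<theta> * of_bool (z \<in> N v \<and> w \<noteq> v) + \<mu> * (real c * codeg v z))" for z
  have x0: "x \<ge> 0" using nonneg codeg_nonneg by (simp add: x_def)
  have g1: "g z \<ge> 1" for z using nonneg codeg_nonneg by (simp add: g_def)
  have "(\<Sum>z\<in>S. g z) = card S + (\<Sum>z\<in>S. g z - 1)" by (simp add: sum_subtractf)
  also have "(\<Sum>z\<in>S. g z - 1) \<le> (\<Sum>z\<in>N w. g z - 1)"
    using S g1 fin_N[OF w] by (intro sum_mono2) (auto simp: w_def)
  also have "\<dots> \<le> d / 2 * x"
    unfolding g_def x_def using v w card_ch_le by (intro sum_exp_increment_le) (auto simp: c_def)
  also have "\<dots> \<le> card S * x" using S x0 by (intro mult_right_mono) auto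
  also have "card S + card S * x \<le> card S * exp x"
    using mult_left_mono[OF exp_ge_add_one_self[of x], of "card S"] by (simp add: algebra_simps)
  finally have g: "(\<Sum>z\<in>S. g z) \<le> card S * exp x" by simp
  have "weight v (insert y E) (f(y := z)) = weight v E f * exp (- x) * g z" for z
    unfolding weight_def hits_insert pending_insert budget_insert g_def x_def
    by (simp add: w_def c_def algebra_simps flip: exp_add)
  then have "(\<Sum>z\<in>S. weight v (insert y E) (f(y := z))) = weight v E f * exp (- x) * (\<Sum>z\<in>S. g z)"
    by (simp add: sum_distrib_left)
  also have "\<dots> \<le> weight v E f * exp (- x) * (card S * exp x)"
    using g by (intro mult_left_mono) (auto simp: weight_def)
  also have "\<dots> = card S * weight v E f" by (simp add: exp_minus field_simps)
  finally show ?thesis .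
qed

end

section \<open>Activation of vertices and the total potential\<close>

lemma fin_reach: "state E f \<Longrightarrow> finite (reach E f)"
  unfolding reach_def using stateD(1,4)[of E f] by (auto intro!: finite_UN_I fin_N)

lemma card_active: "state E f \<Longrightarrow> card (active E f) \<le> M"
proof -
  assume st: "state E f"
  note D = stateD[OF st]
  have "card (reach E f) \<le> card (f ` E) + card (\<Union> (N ` f ` E))"
    unfolding reach_def by (rule card_Un_le)
  also have "card (\<Union> (N ` f ` E)) \<le> (\<Sum>w\<in>f ` E. card (N w))"
    using D by (intro card_UN_le) auto
  also have "\<dots> = card (f ` E) * d" using card_N D by (simp add: subset_iff)
  also have "card (f ` E) + card (f ` E) * d = card (f ` E) * (d + 1)" by simp
  also have "\<dots> \<le> card VT * (d + 1)"
    using D fin_VT card_image_le[of E f] card_mono[of VT E] by (intro mult_right_mono) linarith+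
  finally have "card (reach E f) \<le> card VT * (d + 1)" by simp
  moreover have "reach E f \<subseteq> V" unfolding reach_def using D N_subset by blast
  ultimately show ?thesis unfolding active_def by (rule card_dense[rotated])
qed

text \<open>The images of the hits are distinct points of \<open>N v \<inter> reach E f\<close>, and
  the common chosen neighbours with any one occupied vertex lie there too. This set has fewer than
  \<open>t\<close> points.\<close>

lemma not_active_bounds:
  assumes st: "state E f" and v: "v \<in> V" "v \<notin> active E f"
  shows "hits v E f \<le> t - 1" "pending v E f \<le> real (t - 1) * card VT"
proof -
  note D = stateD[OF st]
  have Z: "card (N v \<inter> reach E f) \<le> t - 1" using v by (auto simp: active_def)
  have fin: "finite (N v \<inter> reach E f)" using fin_reach[OF st] by simp
  have "hits v E f \<le> card (N v \<inter> reach E f)"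
    unfolding hits_def using fin inj_on_subset[OF D(5)]
    by (intro card_inj_on_le[of f]) (auto simp: reach_def)
  then show "hits v E f \<le> t - 1" using Z by simp
  have le: "codeg v (f u) \<le> real (t - 1)" if "u \<in> E" for u
  proof -
    have "card (N v \<inter> N (f u)) \<le> card (N v \<inter> reach E f)"
      using that fin by (intro card_mono) (auto simp: reach_def)
    then have "card (N v \<inter> N (f u)) \<le> t - 1" using Z by simp
    then show ?thesis by (simp add: codeg_def)
  qed
  have "pending v E f \<le> (\<Sum>y\<in>VT - E. real (t - 1))"
    unfolding pending_def using le by (intro sum_mono) auto
  also have "\<dots> \<le> real (t - 1) * card VT"
    using card_mono[OF fin_VT, of "VT - E"]
    by (auto simp: mult.commute intro!: mult_right_mono)
  finally show "pending v E f \<le> real (t - 1) * card VT" .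
qed

text \<open>One step adds at most one hit to the \<open>t - 1\<close> possible before, and at most
  \<open>\<Delta> * d\<close> to \<open>pending\<close>.\<close>

lemma entry_weight:
  assumes st: "state E f" and y: "y \<in> VT - E" "par y \<in> E" and v: "v \<in> V" "v \<notin> active E f"
  shows "weight v (insert y E) (f(y := z)) \<le> entry"
proof -
  have "hits v (insert y E) (f(y := z)) \<le> t"
    using not_active_bounds(1)[OF st v] t_pos unfolding hits_insert[OF st y] by auto
  moreover have "card (ch y) * codeg v z \<le> real \<Delta> * real d"
    using card_ch_le codeg_le[OF v(1)] codeg_nonneg by (intro mult_mono) auto
  then have "pending v (insert y E) (f(y := z)) \<le> real (t - 1) * card VT + real \<Delta> * d"
    using not_active_bounds(2)[OF st v] codeg_nonneg[of v "f (par y)"]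
    unfolding pending_insert[OF st y] by linarith
  ultimately show ?thesis
    unfolding weight_def entry_def using nonneg budget_bounds(2)
    by (simp only: exp_le_cancel_iff) (intro add_mono mult_left_mono; simp)
qed

lemma active_mono:
  assumes st: "state E f" and "y \<in> VT - E" and "z \<in> V"
  shows "active E f \<subseteq> active (insert y E) (f(y := z))"
proof -
  have "reach E f \<subseteq> reach (insert y E) (f(y := z))"
    using assms by (auto simp: reach_def)
  then have "card (N v \<inter> reach E f) \<le> card (N v \<inter> reach (insert y E) (f(y := z)))" if "v \<in> V" for v
    using fin_N[OF that] by (intro card_mono) auto
  then show ?thesis unfolding active_def by (auto intro: order_trans)
qed

text \<open>The new active set depends on \<open>z\<close>. Comparing first with the old set
  \<open>A\<close> removes this dependence, after which the sums over \<open>z\<close> and over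
  \<open>v\<close> can be exchanged.\<close>

theorem potential_supermartingale:
  assumes st: "state E f" and y: "y \<in> VT - E" "par y \<in> E"
    and S: "S \<subseteq> N (f (par y)) - f ` E" "d \<le> 2 * card S"
  shows "(\<Sum>z\<in>S. potential (insert y E) (f(y := z))) \<le> card S * potential E f"
proof -
  define A where "A = active E f"
  have finA: "finite A" and AV: "A \<subseteq> V" using fin_V by (auto simp: A_def active_def)
  have SV: "S \<subseteq> V" using S N_subset stateD(4)[OF st] y by blast
  have "potential (insert y E) (f(y := z))
      \<le> (\<Sum>v\<in>A. weight v (insert y E) (f(y := z))) + (real M - card A) * entry" if "z \<in> S" for z
  proof -
    define A' where "A' = active (insert y E) (f(y := z))"
    have finA': "finite A'" and AV': "A' \<subseteq> V" using fin_V by (auto simp: A'_def active_def)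
    have sub: "A \<subseteq> A'" unfolding A_def A'_def using st y that SV by (intro active_mono) auto
    have "(\<Sum>v\<in>A' - A. weight v (insert y E) (f(y := z))) \<le> (\<Sum>v\<in>A' - A. entry)"
      using AV' by (intro sum_mono entry_weight st y) (auto simp: A_def)
    also have "\<dots> = (real (card A') - card A) * entry"
      using sub finA finA' card_mono[OF finA' sub] by (simp add: card_Diff_subset of_nat_diff)
    finally show ?thesis
      unfolding potential_def A'_def[symmetric]
      using sum.subset_diff[OF sub finA', of "\<lambda>v. weight v (insert y E) (f(y := z))"]
      by (simp add: algebra_simps)
  qed
  then have "(\<Sum>z\<in>S. potential (insert y E) (f(y := z)))
      \<le> (\<Sum>z\<in>S. (\<Sum>v\<in>A. weight v (insert y E) (f(y := z))) + (real M - card A) * entry)"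
    by (rule sum_mono)
  also have "\<dots> = (\<Sum>v\<in>A. \<Sum>z\<in>S. weight v (insert y E) (f(y := z))) + card S * ((real M - card A) * entry)"
    by (simp add: sum.distrib sum.swap[of _ S])
  also have "\<dots> \<le> (\<Sum>v\<in>A. card S * weight v E f) + card S * ((real M - card A) * entry)"
    using AV S by (intro add_right_mono sum_mono weight_supermartingale st y) auto
  also have "\<dots> = card S * potential E f"
    by (simp add: potential_def A_def sum_distrib_left algebra_simps)
  finally show ?thesis .
qed

lemma potential_nonneg: "state E f \<Longrightarrow> 0 \<le> potential E f"
  unfolding potential_def using card_active[of E f]
  by (intro add_nonneg_nonneg sum_nonneg mult_nonneg_nonneg) (auto simp: weight_def entry_def)

text \<open>Vertices may be active from the start, because \<open>N x\<close> is already reached.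
  Their weight is at most \<open>entry\<close> since there are no hits and only the children of the
  root are pending.\<close>

lemma potential_start:
  assumes "x \<in> V" and "f r = x"
  shows "potential {r} f \<le> M * entry"
proof -
  have st: "state {r} f" using assms root_VT by (auto simp: state_def)
  have "weight v {r} f \<le> entry" if v: "v \<in> V" for v
  proof -
    have no_hits: "hits v {r} f = 0" by (simp add: hits_def)
    have "pending v {r} f = (\<Sum>y | y \<in> VT - {r} \<and> par y = r. codeg v (f r))"
      unfolding pending_def sum.inter_filter[OF finite_Diff[OF fin_VT]] by (intro sum.cong) auto
    also have "{y. y \<in> VT - {r} \<and> par y = r} = ch r" by (auto simp: ch_def)
    finally have "pending v {r} f = card (ch r) * codeg v x" using assms by simp
    moreover have "card (ch r) * codeg v x \<le> real \<Delta> * real d"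
      using card_ch_le codeg_le[OF v(1)] codeg_nonneg by (intro mult_mono) auto
    ultimately have "hits v {r} f \<le> t" "pending v {r} f \<le> real (t - 1) * card VT + real \<Delta> * d"
      using no_hits by (auto intro: add_increasing)
    then show ?thesis
      unfolding weight_def entry_def using nonneg budget_bounds(2)
      by (simp only: exp_le_cancel_iff) (intro add_mono mult_left_mono; simp)
  qed
  then have "(\<Sum>v\<in>active {r} f. weight v {r} f) \<le> (\<Sum>v\<in>active {r} f. entry)"
    by (intro sum_mono) (auto simp: active_def)
  then show ?thesis by (simp add: potential_def algebra_simps)
qed

text \<open>Occupied points of \<open>N v\<close> come from hits, except for the image of the root
  and those of at most \<open>\<Delta>\<close> children of a vertex placed at \<open>v\<close>. With
  more than half of \<open>N v\<close> occupied, the weight of \<open>v\<close> alone would reach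
  the bound.\<close>

lemma occupied_le_half:
  assumes st: "state E f" and v: "v \<in> V"
    and small: "potential E f < exp (\<theta> * (d / 2 - \<Delta> - 1))"
  shows "2 * card (N v \<inter> f ` E) \<le> d"
proof (rule ccontr)
  assume *: "\<not> 2 * card (N v \<inter> f ` E) \<le> d"
  note D = stateD[OF st]
  have "card (N v \<inter> f ` E) \<le> card (N v \<inter> reach E f)"
    using fin_N[OF v] by (intro card_mono) (auto simp: reach_def)
  then have act: "v \<in> active E f" using * t_le v by (auto simp: active_def)
  \<comment> \<open>By injectivity at most one vertex is placed at \<open>v\<close>, so the elements
    of \<open>P\<close> are siblings.\<close>
  define P where "P = {y \<in> E. y \<noteq> r \<and> f (par y) = v}"
  have "card P \<le> \<Delta>"
  proof (cases "P = {}")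
    case False
    then obtain y0 where y0: "y0 \<in> P" by auto
    have "P \<subseteq> ch (par y0)"
      using y0 D inj_onD[OF D(5)] by (auto simp: P_def ch_def)
    then show ?thesis using card_mono[OF fin_ch] card_ch_le order_trans by blast
  qed simp
  define Q where "Q = {y \<in> E. y \<noteq> r \<and> f y \<in> N v \<and> f (par y) \<noteq> v}"
  have "N v \<inter> f ` E \<subseteq> f ` (insert r (P \<union> Q))"
    by (auto simp: P_def Q_def)
  then have "card (N v \<inter> f ` E) \<le> card (f ` (insert r (P \<union> Q)))"
    using D(1) by (intro card_mono) (auto simp: P_def Q_def)
  also have "\<dots> \<le> card (insert r (P \<union> Q))"
    using D(1) by (intro card_image_le) (auto simp: P_def Q_def)
  also have "\<dots> \<le> Suc (card (P \<union> Q))" by (rule card_insert_le_m1) auto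
  also have "card (P \<union> Q) \<le> card P + card Q" by (rule card_Un_le)
  also have "card Q = hits v E f" by (simp add: Q_def hits_def)
  finally have "d / 2 - \<Delta> - 1 \<le> real (hits v E f)" using * \<open>card P \<le> \<Delta>\<close> by linarith
  then have "exp (\<theta> * (d / 2 - \<Delta> - 1)) \<le> weight v E f"
    unfolding weight_def using nonneg pending_nonneg budget_bounds(1)
    by (simp only: exp_le_cancel_iff) (simp add: add_increasing2 mult_left_mono)
  also have "\<dots> \<le> (\<Sum>v\<in>active E f. weight v E f)"
    using act fin_V by (intro member_le_sum) (auto simp: weight_def active_def)
  also have "\<dots> \<le> potential E f"
    using card_active[OF st] by (simp add: potential_def entry_def)
  finally show False using small by simp
qed

end

section \<open>Success probability of the algorithm\<close>

lemma measure_bind_spmf: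
  "measure (measure_spmf (bind_spmf p f)) A
    = (\<integral>x. measure (measure_spmf (f x)) A \<partial>measure_spmf p)"
  by (simp add: measure_spmf_bind o_def measure_spmf.measure_bind[where N="count_space UNIV"])

lemma embedded_snoc: "embedded (h @ [(y, z)]) = insert y (embedded h)"
  by (auto simp: embedded_def)

text \<open>\<open>map_of\<close> returns the first entry of a key, so an appended pair takes effect
  only for a new vertex.\<close>

lemma embedding_of_snoc:
  assumes "y \<notin> embedded h"
  shows "embedding_of (h @ [(y, z)]) = (embedding_of h)(y := z)"
proof -
  have "map_of h y = None" using assms by (auto simp: embedded_def map_of_eq_None_iff)
  then show ?thesis by (auto simp: embedding_of_def map_add_def fun_eq_iff split: option.splits)
qed

lemma occupied_eq:
  assumes "distinct (map fst h)"
  shows "occupied h = embedding_of h ` embedded h"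
  using assms unfolding occupied_def embedding_of_def embedded_def
  by (force simp: image_image image_iff)

locale embedding_run = tree_process V N "pverts T" r par d t M \<Delta> \<theta> \<mu> b0 b1 k h S1
  for V :: "'a set" and N and T :: "'b pair_pre_digraph" and r par d t M \<Delta> \<theta> \<mu> b0 b1 k h S1 +
  fixes G :: "'a pair_pre_digraph" and x :: 'a
    and pick :: "('b, 'a) history \<Rightarrow> 'b" and ord :: "('b, 'a) history \<Rightarrow> 'b \<Rightarrow> 'b list"
  assumes V: "V = pverts G" and G: "pair_graph G" and T: "tree_graph T"
    and N_neighbours: "v \<in> V \<Longrightarrow> N v \<subseteq> neighbours G v"
    and par: "y \<in> children T r u \<Longrightarrow> par y = u"
    and x: "x \<in> V" and strategy: "valid_strategy T r pick ord" and room: "2 * \<Delta> \<le> d"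
begin

lemma ch_eq: "ch u = children T r u"
proof (intro set_eqI iffI)
  fix y assume "y \<in> ch u"
  then have y: "y \<in> pverts T" "y \<noteq> r" "par y = u" by (auto simp: ch_def)
  then show "y \<in> children T r u" using parent_exists[OF T root_VT y(1,2)] par by blast
next
  fix y assume "y \<in> children T r u"
  then show "y \<in> ch u"
    using par children_subset[OF T root_VT] root_not_child[OF T root_VT] by (auto simp: ch_def)
qed

definition hist :: "('b, 'a) history \<Rightarrow> bool" where
  "hist g \<longleftrightarrow> distinct (map fst g) \<and> state (embedded g) (embedding_of g)
    \<and> (\<forall>y\<in>embedded g. y \<noteq> r \<longrightarrow> embedding_of g y \<in> N (embedding_of g (par y)))"

definition pot :: "('b, 'a) history \<Rightarrow> real" where
  "pot g = potential (embedded g) (embedding_of g)"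

text \<open>Below this potential at least half of every \<open>N v\<close> is free, by
  \<open>occupied_le_half\<close>.\<close>

definition threshold :: real where
  "threshold = exp (\<theta> * (d / 2 - \<Delta> - 1))"

definition complete :: "('b, 'a) history set" where
  "complete = {g. hist g \<and> embedded g = pverts T}"

lemma threshold_pos: "threshold > 0"
  by (simp add: threshold_def)

lemma hist_snoc:
  assumes g: "hist g" and y: "y \<in> pverts T - embedded g" "par y \<in> embedded g"
    and z: "z \<in> N (embedding_of g (par y)) - occupied g"
  shows "hist (g @ [(y, z)])"
proof -
  have st: "state (embedded g) (embedding_of g)" and dist: "distinct (map fst g)"
    using g by (auto simp: hist_def)
  note D = stateD[OF st]
  have "z \<in> V" using z N_subset D(4) y(2) by blast
  then have "state (insert y (embedded g)) ((embedding_of g)(y := z))"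
    using z st y by (intro state_insert) (auto simp: occupied_eq[OF dist])
  moreover have "y \<notin> fst ` set g" using y by (simp add: embedded_def)
  moreover have "par y' \<noteq> y" if "y' \<in> embedded g" "y' \<noteq> r" for y'
    using D(6)[OF that] y(1) by blast
  ultimately show ?thesis
    using g y z unfolding hist_def
    by (auto simp: embedded_snoc embedding_of_snoc)
qed

lemma is_embedding_complete:
  assumes "g \<in> complete"
  shows "is_embedding T G (embedding_of g)"
proof -
  interpret G: pair_graph G by (rule G)
  have g: "hist g" "embedded g = pverts T" using assms by (auto simp: complete_def)
  then have D: "embedding_of g ` pverts T \<subseteq> V" "inj_on (embedding_of g) (pverts T)"
    using stateD(4,5) by (auto simp: hist_def)
  have child: "(embedding_of g u, embedding_of g w) \<in> parcs G"
    if "u \<in> pverts T" "w \<in> children T r u" for u w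
  proof -
    have "w \<in> pverts T" "w \<noteq> r" "par w = u"
      using that children_subset[OF T root_VT] root_not_child[OF T root_VT] par by auto
    then have "embedding_of g w \<in> N (embedding_of g u)" using g by (auto simp: hist_def)
    then show ?thesis using N_neighbours D(1) that(1) by (auto simp: neighbours_def)
  qed
  have "(embedding_of g u, embedding_of g w) \<in> parcs G" if uw: "(u, w) \<in> parcs T" for u w
  proof -
    interpret T: pair_graph T using T by (simp add: tree_graph_def)
    show ?thesis
      using arc_child[OF T root_VT uw] child T.in_arcsD1[OF uw] T.in_arcsD2[OF uw] G.arcs_symmetric
      by blast
  qed
  then show ?thesis using D by (auto simp: is_embedding_def V)
qed

section \<open>Backward induction on the run\<close>

lemma room_left:
  assumes g: "hist g" "pot g < threshold" and u: "u \<in> embedded g"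
  shows "d \<le> 2 * card (N (embedding_of g u) - occupied g)"
proof -
  have st: "state (embedded g) (embedding_of g)" and dist: "distinct (map fst g)"
    using g by (auto simp: hist_def)
  define w where "w = embedding_of g u"
  have w: "w \<in> V" using stateD(4)[OF st] u by (auto simp: w_def)
  have "2 * card (N w \<inter> occupied g) \<le> d"
    using occupied_le_half[OF st w] g(2) unfolding pot_def threshold_def occupied_eq[OF dist] .
  then show ?thesis
    using card_N[OF w] card_Diff_subset_Int[of "N w" "occupied g"] fin_N[OF w]
    unfolding w_def[symmetric] by simp
qed

text \<open>Induction over the children still to be embedded, with \<open>K\<close> as the rest of
  the run. Carrying \<open>1 - pot g / threshold\<close> backwards as a lower bound on the success
  probability takes the place of a stopping time and Markov's inequality.\<close>

lemma embed_list_bound: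
  assumes "hist g" and "u \<in> embedded g" and "set ws \<subseteq> children T r u - embedded g"
    and "distinct ws" and "A = N (embedding_of g u)"
    and "\<And>g'. hist g' \<Longrightarrow> embedded g' = embedded g \<union> set ws
      \<Longrightarrow> 1 - pot g' / threshold \<le> measure (measure_spmf (K g')) complete"
  shows "1 - pot g / threshold \<le> measure (measure_spmf (bind_spmf (embed_list A ws g) K)) complete"
  using assms
proof (induction ws arbitrary: g)
  case Nil
  then show ?case by simp
next
  case (Cons w ws)
  show ?case
  proof (cases "pot g < threshold")
    \<comment> \<open>Once the potential has reached the threshold, the claimed bound is not
      positive, so possible failure from here on does no harm.\<close>
    case False
    then have "1 - pot g / threshold \<le> 0" using threshold_pos by simp
    then show ?thesis using measure_nonneg order_trans by blast
  next
    case True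
    define S where "S = A - occupied g"
    have st: "state (embedded g) (embedding_of g)" and dist: "distinct (map fst g)"
      using Cons.prems(1) by (auto simp: hist_def)
    have w: "w \<in> pverts T - embedded g" "par w = u"
      using Cons.prems(3) children_subset[OF T root_VT] par by auto
    have snoc: "embedding_of (g @ [(w, z)]) = (embedding_of g)(w := z)" for z
      using w by (simp add: embedding_of_snoc)
    have S: "d \<le> 2 * card S" unfolding S_def Cons.prems(5) by (rule room_left) fact+
    then have S0: "card S > 0" using d_pos by simp
    have step: "1 - pot (g @ [(w, y)]) / threshold
        \<le> measure (measure_spmf (bind_spmf (embed_list A ws (g @ [(w, y)])) K)) complete"
      if y: "y \<in> S" for y
    proof (rule Cons.IH)
      show "hist (g @ [(w, y)])"
        using Cons.prems w y by (intro hist_snoc) (auto simp: S_def)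
      show "set ws \<subseteq> children T r u - embedded (g @ [(w, y)])"
        using Cons.prems(3,4) by (auto simp: embedded_snoc)
      show "A = N (embedding_of (g @ [(w, y)]) u)"
        using Cons.prems(2,5) w by (auto simp: embedding_of_snoc)
    qed (use Cons.prems in \<open>auto simp: embedded_snoc\<close>)
    \<comment> \<open>At least half of \<open>A\<close> is free, so the potential does not grow on
      average over the uniform choice from \<open>S\<close>; averaging \<open>step\<close> then
      gives the claim.\<close>
    have "(\<Sum>y\<in>S. pot (g @ [(w, y)])) \<le> card S * pot g"
      unfolding pot_def embedded_snoc snoc
      using S Cons.prems(2,5) w
      by (intro potential_supermartingale st) (auto simp: S_def occupied_eq[OF dist])
    then have "card S * (1 - pot g / threshold) \<le> (\<Sum>y\<in>S. 1 - pot (g @ [(w, y)]) / threshold)"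
      using threshold_pos by (simp add: sum_subtractf field_simps flip: sum_divide_distrib)
    also have "\<dots> \<le> (\<Sum>y\<in>S. measure (measure_spmf (bind_spmf (embed_list A ws (g @ [(w, y)])) K)) complete)"
      by (intro sum_mono step)
    finally show ?thesis
      using S0 by (simp add: measure_bind_spmf integral_spmf_of_set S_def field_simps)
  qed
qed

text \<open>An invariant between rounds only: it may fail while the children of one vertex are being
  embedded, and so it is kept apart from \<open>hist\<close>.\<close>

definition rounded :: "('b, 'a) history \<Rightarrow> bool" where
  "rounded g \<longleftrightarrow> (\<forall>u\<in>embedded g. children T r u \<subseteq> embedded g \<or> children T r u \<inter> embedded g = {})"

text \<open>A newly embedded vertex has no embedded child because \<open>embedded g\<close> is
  closed under parents. For the other vertices nothing changes, as child sets are disjoint.\<close>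

lemma rounded_step:
  assumes g: "hist g" "rounded g" and "u \<in> embedded g"
    and g': "embedded g' = embedded g \<union> children T r u"
  shows "rounded g'"
  unfolding rounded_def
proof
  fix v assume v: "v \<in> embedded g'"
  have disj: "children T r v \<inter> children T r u = {}" if "v \<noteq> u" using that par by blast
  show "children T r v \<subseteq> embedded g' \<or> children T r v \<inter> embedded g' = {}"
  proof (cases "v \<in> embedded g")
    case True
    then show ?thesis using g(2) disj g' by (cases "v = u") (auto simp: rounded_def)
  next
    case False
    have "y \<notin> embedded g" if "y \<in> children T r v" for y
      using stateD(6) g(1) par[OF that] root_not_child[OF T root_VT] that False
      by (metis hist_def)
    then show ?thesis using False g' disj assms(3) by blast
  qed
qed

text \<open>Each round lowers the number of vertices not yet embedded, so one unfolding of the loop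
  per induction step suffices.\<close>

lemma loop_bound:
  assumes "hist g" "rounded g"
  shows "1 - pot g / threshold \<le> measure (measure_spmf (algorithm2_loop T N pick ord g)) complete"
  using assms
proof (induction "card (pverts T - embedded g)" arbitrary: g rule: less_induct)
  case less
  have st: "state (embedded g) (embedding_of g)" using less.prems by (simp add: hist_def)
  note D = stateD[OF st]
  consider "embedded g = pverts T" | "threshold \<le> pot g"
    | "embedded g \<noteq> pverts T" "pot g < threshold" by linarith
  then show ?case
  proof cases
    case 1
    then have "algorithm2_loop T N pick ord g = return_spmf g"
      by (subst algorithm2_loop.simps) simp
    moreover have "g \<in> complete" using 1 less.prems by (simp add: complete_def)
    moreover have "0 \<le> pot g" unfolding pot_def using st by (rule potential_nonneg)
    ultimately show ?thesis
      using threshold_pos by (simp add: measure_spmf_return_spmf measure_return)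
  next
    case 2
    then have "1 - pot g / threshold \<le> 0" using threshold_pos by simp
    then show ?thesis using measure_nonneg order_trans by blast
  next
    case 3
    \<comment> \<open>If nothing can be picked, \<open>rounded\<close> makes the embedded set closed
      under children, so it is all of \<open>T\<close>.\<close>
    have "pickable T r g \<noteq> {}"
    proof
      assume *: "pickable T r g = {}"
      have "embedded g = pverts T"
        using * less.prems(2) D
        by (intro children_closed_eq_verts[OF T root_VT]) (auto simp: pickable_def rounded_def)
      then show False using 3 by simp
    qed
    then have "pick g \<in> pickable T r g" using strategy by (simp add: valid_strategy_def)
    then obtain u where u: "pick g = u" "u \<in> embedded g" "children T r u \<noteq> {}"
      "children T r u \<inter> embedded g = {}" by (auto simp: pickable_def)
    have ws: "distinct (ord g u)" "set (ord g u) = children T r u"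
      using strategy u D(2) by (auto simp: valid_strategy_def)
    define A where "A = N (embedding_of g u)"
    have "length (ord g u) = card (ch u)" using ws distinct_card ch_eq by metis
    then have "2 * length (ord g u) \<le> d" using card_ch_le[of u] room by linarith
    then have "length (ord g u) \<le> card (A - occupied g)"
      using room_left[OF less.prems(1) 3(2) u(2)] unfolding A_def by linarith
    then have "algorithm2_loop T N pick ord g
        = bind_spmf (embed_list A (ord g u) g) (algorithm2_loop T N pick ord)"
      using 3(1) by (subst algorithm2_loop.simps) (simp add: embed_children_def u A_def)
    moreover have "1 - pot g / threshold
        \<le> measure (measure_spmf (bind_spmf (embed_list A (ord g u) g) (algorithm2_loop T N pick ord))) complete"
    proof (rule embed_list_bound[OF less.prems(1) u(2)])
      fix g' assume g': "hist g'" "embedded g' = embedded g \<union> set (ord g u)"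
      have "pverts T - embedded g' \<subset> pverts T - embedded g"
        using g' ws u children_subset[OF T root_VT, of u] by auto
      then have "card (pverts T - embedded g') < card (pverts T - embedded g)"
        using fin_VT by (intro psubset_card_mono) auto
      then show "1 - pot g' / threshold
          \<le> measure (measure_spmf (algorithm2_loop T N pick ord g')) complete"
        using g' ws rounded_step[OF less.prems u(2)] by (intro less.hyps) auto
    qed (use ws u A_def in auto)
    ultimately show ?thesis by simp
  qed
qed

theorem algorithm2_success:
  "1 - M * entry / threshold
    \<le> measure (measure_spmf (algorithm2 T N r x pick ord)) {f. is_embedding T G f}"
proof -
  define g where "g = [(r, x)]"
  have e: "embedded g = {r}" "embedding_of g r = x"
    by (auto simp: g_def embedded_def embedding_of_def)
  have "hist g" using x root_VT e unfolding hist_def state_def by (auto simp: g_def)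
  moreover have "rounded g" using root_not_child[OF T root_VT] by (auto simp: rounded_def e)
  ultimately have "1 - pot g / threshold
      \<le> measure (measure_spmf (algorithm2_loop T N pick ord g)) complete"
    by (rule loop_bound)
  also have "\<dots> \<le> measure (measure_spmf (algorithm2_loop T N pick ord g))
      (embedding_of -` {f. is_embedding T G f})"
    using is_embedding_complete by (intro measure_spmf.finite_measure_mono) auto
  also have "\<dots> = measure (measure_spmf (algorithm2 T N r x pick ord)) {f. is_embedding T G f}"
    by (simp add: algorithm2_def measure_map_spmf g_def)
  finally have "1 - pot g / threshold
    \<le> measure (measure_spmf (algorithm2 T N r x pick ord)) {f. is_embedding T G f}" .
  moreover have "pot g / threshold \<le> M * entry / threshold"
    using potential_start[of x "embedding_of g", OF x e(2)] threshold_pos unfolding pot_def e(1)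
    by (intro divide_right_mono) auto
  ultimately show ?thesis by linarith
qed

end

section \<open>Choice of the parameters\<close>

lemma eventually_small:
  fixes f :: "nat \<Rightarrow> real"
  assumes "f \<longlonglongrightarrow> 0" "e > 0"
  shows "\<forall>\<^sub>F n in sequentially. c * f n \<le> e"
proof -
  have "(\<lambda>n. c * f n) \<longlonglongrightarrow> 0" using tendsto_mult_right_zero[OF assms(1)] by simp
  then have "\<forall>\<^sub>F n in sequentially. c * f n < e" using assms(2) by (rule order_tendstoD)
  then show ?thesis by (rule eventually_mono) simp
qed

text \<open>
  The scale is \<open>\<theta> d = 12 t ln d\<close>: in units of \<open>t ln d\<close>, the threshold contributes \<open>6\<close>, the number
  \<open>M\<close> of tracked vertices \<open>3\<close>, the main term of the budget \<open>b1 m\<close> about \<open>1.8\<close>, and everything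
  else less than \<open>1\<close>. The exponent \<open>27/64 = (9/4) (12/64)\<close> bounding the effect of a vertex of large
  codegree must stay below \<open>1/2\<close>.
\<close>

definition admissible ::
  "nat \<Rightarrow> nat \<Rightarrow> nat \<Rightarrow> nat \<Rightarrow> nat \<Rightarrow> real \<Rightarrow> real \<Rightarrow> real \<Rightarrow> real \<Rightarrow> real \<Rightarrow> real \<Rightarrow> real \<Rightarrow> real \<Rightarrow> real \<Rightarrow> bool"
  where
  "admissible s t d m \<Delta> \<epsilon> \<theta> \<mu> b0 b1 k h \<rho> S1 \<longleftrightarrow>
    \<rho> > 0 \<and> real d * \<rho> ^ (t - 1) = s \<and> 2 * t \<le> d \<and> 2 * \<Delta> \<le> d
    \<and> 0 \<le> \<theta> \<and> 0 \<le> \<mu> \<and> 0 \<le> b0 \<and> 0 \<le> b1 \<and> 0 < k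
    \<and> S1 = 2 * real d * d * \<rho> + real (t - 2) * d
    \<and> 4 * real d * \<rho> \<le> k \<and> h * k = 2 * real (t - 2) * d
    \<and> 2 / d * ((exp \<theta> - 1) * exp (\<mu> * \<Delta> * k)) \<le> \<mu>
    \<and> 2 / d * ((exp \<theta> - 1) * (h * exp (\<mu> * \<Delta> * d))) \<le> b0
    \<and> 2 / d * (\<mu> * (exp (\<mu> * \<Delta> * k) * S1 + h * d * exp (\<mu> * \<Delta> * d))) \<le> b1
    \<and> s * (real m * (real d + 1)) ^ t
        * exp (\<theta> * t + \<mu> * (real (t - 1) * m + real \<Delta> * d) + (b0 + b1) * m)
      \<le> \<epsilon> * exp (\<theta> * (d / 2 - \<Delta> - 1))"

text \<open>The quantifiers over \<open>m\<close> and \<open>\<Delta>\<close> are inside, so one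
  lower bound on \<open>d\<close> serves all trees at once.\<close>

lemma eventually_parameters:
  fixes s t :: nat and \<epsilon> :: real
  assumes t: "2 \<le> t" and s: "2 \<le> s" and \<epsilon>: "\<epsilon> > 0"
  shows "\<forall>\<^sub>F d in sequentially. \<forall>m \<Delta> :: nat.
    real m \<le> 1 / 64 * real s powr (- 1 / (real t - 1)) * real d powr (real t / (real t - 1)) \<longrightarrow>
    real \<Delta> \<le> 1 / (64 * real t) * real d \<longrightarrow>
    (\<exists>\<theta> \<mu> b0 b1 k h \<rho> S1. admissible s t d m \<Delta> \<epsilon> \<theta> \<mu> b0 b1 k h \<rho> S1)"
proof -
  define j where "j = real t - 1"
  have j: "j \<ge> 1" "real (t - 1) = j" "t / j = 1 + 1 / j" using t by (auto simp: j_def field_simps)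
  have inv_j: "1 / j > 0" "1 / j \<le> 1" using j by auto
  have lim: "(\<lambda>d. ln (real d) ^ 2 / real d powr (1 / j)) \<longlonglongrightarrow> 0"
    using inv_j(1) by real_asymp
  have ev: "\<forall>\<^sub>F d in sequentially. real d \<ge> max 2 (max (2 * t) s)"
    "\<forall>\<^sub>F d in sequentially. ln (real d) \<ge> 1"
    by real_asymp+
  have ev2: "\<forall>\<^sub>F d in sequentially. 12 * real t * (ln (real d) / d) \<le> 6 / 100"
    "\<forall>\<^sub>F d in sequentially. 27 / 64 * (1 / ln (real d)) \<le> 5 / 100"
    "\<forall>\<^sub>F d in sequentially. (4 * s powr (1 / j)) * (ln (real d) ^ 2 / real d powr (1 / j)) \<le> 1"
    "\<forall>\<^sub>F d in sequentially. (2 * real t) * (1 / sqrt (real d)) \<le> 1"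
    "\<forall>\<^sub>F d in sequentially. 12 * real t * (1 / real d) \<le> 1 / 100"
    "\<forall>\<^sub>F d in sequentially. real t * (1 / sqrt (real d)) \<le> 1 / 100"
    "\<forall>\<^sub>F d in sequentially. (2 * real t) * (ln (real d) ^ 2 * real d powr (27/64) / sqrt (real d)) \<le> 1 / 100"
    "\<forall>\<^sub>F d in sequentially. (ln s - ln \<epsilon>) * (1 / ln (real d)) \<le> 2 / 10"
    by (rule eventually_small; (rule lim | real_asymp | simp))+
  show ?thesis
    using ev ev2
  proof eventually_elim
    case (elim d)
    define D where "D = real d"
    define l where "l = ln D"
    define x where "x = 1 / j"
    have D: "D \<ge> 2" "D \<ge> 2 * t" "D \<ge> s" and l: "l \<ge> 1"
      using elim(1,2) by (auto simp: D_def l_def)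
    have lD: "exp l = D" using D by (simp add: l_def)
    define \<rho> where "\<rho> = (s / D) powr x"
    have x: "0 < x" "x \<le> 1" using inv_j by (auto simp: x_def)
    have \<rho>0: "\<rho> > 0" using s D by (simp add: \<rho>_def)
    have \<rho>pow: "D * \<rho> ^ (t - 1) = s"
    proof -
      have "\<rho> ^ (t - 1) = \<rho> powr j" using \<rho>0 j by (simp flip: powr_realpow)
      also have "\<dots> = s / D" using s D j by (simp add: \<rho>_def powr_powr x_def)
      finally show ?thesis using D by simp
    qed
    have \<rho>ge: "\<rho> \<ge> s / D"
    proof -
      have "(s / D) powr 1 \<le> (s / D) powr x"
        using s D x by (intro powr_mono') auto
      then show ?thesis using s D by (simp add: \<rho>_def)
    qed
    \<comment> \<open>For \<open>t = 2\<close> all terms with the factor \<open>t - 2\<close>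
      vanish. For larger \<open>t\<close> this bound lowers the size of the tree from order
      \<open>D ^ 2\<close> to order \<open>D * sqrt D\<close>, which makes these terms
      negligible.\<close>
    have t3: "t \<ge> 3 \<Longrightarrow> \<rho> \<ge> 1 / sqrt D"
    proof -
      assume "t \<ge> 3"
      then have "x \<le> 1 / 2" by (simp add: x_def j_def field_simps)
      have "1 / sqrt D = (1 / D) powr (1 / 2)" using D by (simp add: powr_half_sqrt real_sqrt_divide)
      also have "\<dots> \<le> (1 / D) powr x" using D \<open>x \<le> 1 / 2\<close> by (intro powr_mono') auto
      also have "\<dots> \<le> \<rho>" unfolding \<rho>_def using s D x by (intro powr_mono2 divide_right_mono) auto
      finally show ?thesis .
    qed
    define \<theta> where "\<theta> = 12 * real t * l / D"
    \<comment> \<open>The factor 9/4 exceeds 2 * 1.06 * 1.06, where 1.06 comes once from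
      \<open>exp \<theta> - 1\<close> and once from \<open>L\<close>.\<close>
    define \<mu> where "\<mu> = 9 / 4 * \<theta> / D"
    \<comment> \<open>Large enough to exceed \<open>4 * D * \<rho>\<close>, since
      \<open>\<rho>\<close> is polynomially small, yet small enough that
      \<open>\<mu> * \<Delta> * k\<close> is of order \<open>1 / l\<close>. The value of
      \<open>h\<close> is then forced by the condition on \<open>h * k\<close>.\<close>
    define k where "k = D / l ^ 2"
    define h where "h = 2 * real (t - 2) * l ^ 2"
    have \<theta>: "\<theta> > 0" "\<theta> \<le> 6 / 100" "\<theta> * D = 12 * t * l"
      using t l D elim(3) by (auto simp: \<theta>_def l_def D_def)
    have \<mu>: "\<mu> > 0" using \<theta> D by (simp add: \<mu>_def)
    have e\<theta>: "exp \<theta> - 1 \<le> 106 / 100 * \<theta>"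
    proof -
      have "exp \<theta> \<le> 1 + \<theta> + \<theta> ^ 2" using \<theta> by (intro exp_bound) auto
      also have "\<theta> ^ 2 \<le> 6 / 100 * \<theta>" using \<theta> by (simp add: power2_eq_square)
      finally show ?thesis by simp
    qed
    have k0: "k > 0" using D l by (simp add: k_def)
    have \<rho>k: "4 * D * \<rho> \<le> k"
    proof -
      have "4 * \<rho> * l ^ 2 \<le> 1"
        using elim(5) s D by (simp add: \<rho>_def powr_divide x_def l_def D_def)
      then have "D * (4 * \<rho> * l ^ 2) \<le> D * 1" using D by (intro mult_left_mono) auto
      then show ?thesis using l by (simp add: k_def field_simps)
    qed
    show ?case
    proof (intro allI impI)
      fix m \<Delta> :: nat
      assume m: "real m \<le> 1 / 64 * real s powr (- 1 / (real t - 1)) * real d powr (real t / (real t - 1))"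
        and \<Delta>: "real \<Delta> \<le> 1 / (64 * real t) * real d"
      \<comment> \<open>In terms of \<open>\<rho>\<close> the assumed bound on the size of the tree
        is \<open>D / (64 * \<rho>)\<close>.\<close>
      have m\<rho>: "m * \<rho> \<le> D / 64"
      proof -
        have "real s powr (- 1 / (real t - 1)) * real d powr (real t / (real t - 1)) = s powr (- x) * D powr (1 + x)"
          using j(3) by (simp add: x_def D_def j_def)
        also have "\<dots> = D / \<rho>"
          using s D by (simp add: \<rho>_def powr_divide powr_minus powr_add field_simps)
        finally have "m \<le> 1 / 64 * (D / \<rho>)" using m by (simp add: mult.assoc)
        then show ?thesis using \<rho>0 by (simp add: field_simps)
      qed
      have m2: "real m * real s \<le> D ^ 2 / 64"
      proof -
        have "m * (s / D) \<le> m * \<rho>" using \<rho>ge by (intro mult_left_mono) auto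
        then have "real m * real s \<le> D * (m * \<rho>)" using D by (simp add: field_simps)
        also have "\<dots> \<le> D * (D / 64)" using m\<rho> D by (intro mult_left_mono) auto
        finally have "real m * real s \<le> D * (D / 64)" .
        then show ?thesis by (simp add: power2_eq_square)
      qed
      have m128: "m \<le> D ^ 2 / 128"
      proof -
        have "real m * 2 \<le> real m * real s" using s by (intro mult_left_mono) auto
        then show ?thesis using m2 by simp
      qed
      have mt3: "real (t - 2) * m \<le> real (t - 2) * (D * sqrt D / 64)"
      proof (cases "t \<ge> 3")
        case True
        have "m * (1 / sqrt D) \<le> m * \<rho>" using t3[OF True] by (intro mult_left_mono) auto
        then have "m * (1 / sqrt D) \<le> D / 64" using m\<rho> by linarith
        then have "m \<le> D * sqrt D / 64" using D by (simp add: field_simps)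
        then show ?thesis by (intro mult_left_mono) auto
      qed (use t in auto)
      have tm: "real (t - 1) * m \<le> D ^ 2 / 128"
      proof (cases "t \<ge> 3")
        case True
        have "m * (1 / sqrt D) \<le> m * \<rho>" using t3[OF True] by (intro mult_left_mono) auto
        then have "m * (1 / sqrt D) \<le> D / 64" using m\<rho> by linarith
        then have "m \<le> D * sqrt D / 64" using D by (simp add: field_simps)
        then have "real (t - 1) * m \<le> real t * (D * sqrt D / 64)" by (intro mult_mono) auto
        also have "\<dots> \<le> (sqrt D / 2) * (D * sqrt D / 64)"
          using elim(6) D by (intro mult_right_mono) (auto simp: D_def field_simps)
        also have "\<dots> = D ^ 2 / 128" using D by (simp add: power2_eq_square)
        finally show ?thesis .
      next
        case False
        then have "t = 2" using t by simp
        then show ?thesis using m128 by simp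
      qed
      have t\<Delta>: "real t * real \<Delta> \<le> D / 64" using \<Delta> t by (simp add: D_def field_simps)
      have \<Delta>2: "2 * real \<Delta> \<le> real t * real \<Delta>" using t by (intro mult_right_mono) auto
      have \<theta>\<Delta>: "\<theta> * \<Delta> \<le> 12 / 64 * l"
      proof -
        have "\<theta> * \<Delta> = 12 * l * (real t * real \<Delta> / D)" by (simp add: \<theta>_def)
        also have "\<dots> \<le> 12 * l * (1 / 64)"
          using t\<Delta> D l by (intro mult_left_mono) (auto simp: field_simps)
        finally show ?thesis by simp
      qed
      have \<mu>\<Delta>D: "\<mu> * \<Delta> * D \<le> 27 / 64 * l" using \<theta>\<Delta> D by (simp add: \<mu>_def)
      have \<mu>\<Delta>k: "\<mu> * \<Delta> * k \<le> 5 / 100"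
      proof -
        have "\<mu> * \<Delta> * k = \<mu> * \<Delta> * D / l ^ 2" by (simp add: k_def)
        also have "\<dots> \<le> (27 / 64 * l) / l ^ 2" using \<mu>\<Delta>D by (intro divide_right_mono) auto
        also have "\<dots> = 27 / 64 * (1 / l)" using l by (simp add: power2_eq_square)
        also have "\<dots> \<le> 5 / 100" using elim(4) by (simp add: l_def D_def)
        finally show ?thesis .
      qed
      define L where "L = exp (\<mu> * \<Delta> * k)"
      define B where "B = exp (\<mu> * \<Delta> * D)"
      have L: "L \<le> 106 / 100"
      proof -
        define y where "y = \<mu> * \<Delta> * k"
        have y: "0 \<le> y" "y \<le> 5 / 100" using \<mu>\<Delta>k \<mu> k0 by (auto simp: y_def)
        have "exp y \<le> 1 + y + y ^ 2" using y by (intro exp_bound) auto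
        also have "y ^ 2 \<le> (5 / 100) ^ 2" using y by (intro power_mono) auto
        finally show ?thesis using y unfolding L_def y_def[symmetric] by (simp add: power2_eq_square)
      qed
      have B: "B \<le> D powr (27 / 64)"
        using \<mu>\<Delta>D D by (simp add: B_def powr_def l_def)
      have LB0: "L > 0" "B > 0" by (auto simp: L_def B_def)
      define S1 where "S1 = 2 * D * D * \<rho> + real (t - 2) * D"
      define b0 where "b0 = 2 / D * ((exp \<theta> - 1) * (h * B))"
      define b1 where "b1 = 2 / D * (\<mu> * (L * S1 + h * D * B))"
      have h0: "h \<ge> 0" by (simp add: h_def)
      have S10: "S1 \<ge> 0" using \<rho>0 D by (simp add: S1_def)
      have b0: "b0 \<ge> 0" using \<theta> h0 LB0 D by (simp add: b0_def)
      have b1: "b1 \<ge> 0" using \<mu> h0 LB0 D S10 by (simp add: b1_def)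
      have cond: "2 / D * ((exp \<theta> - 1) * L) \<le> \<mu>"
      proof -
        have "(exp \<theta> - 1) * L \<le> (106 / 100 * \<theta>) * (106 / 100)"
          using e\<theta> L LB0 \<theta> by (intro mult_mono) auto
        also have "\<dots> \<le> 9 / 8 * \<theta>" using \<theta> by simp
        finally have "2 / D * ((exp \<theta> - 1) * L) \<le> 2 / D * (9 / 8 * \<theta>)"
          using D by (intro mult_left_mono) auto
        then show ?thesis by (simp add: \<mu>_def)
      qed
      have Dsq: "D / sqrt D = sqrt D" using D by (simp add: real_div_sqrt)
      \<comment> \<open>By \<open>mt3\<close> the product has order at most
        \<open>l ^ 2 * D powr (27 / 64) * D * sqrt D\<close>, which is of smaller order than
        \<open>D ^ 2\<close> because 27/64 is below 1/2.\<close>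
      have hB: "h * B * m * 2 \<le> D ^ 2 / 1600"
      proof -
        have "h * B * m = 2 * l ^ 2 * B * (real (t - 2) * m)" by (simp add: h_def)
        also have "\<dots> \<le> 2 * l ^ 2 * D powr (27 / 64) * (real t * (D * sqrt D / 64))"
        proof (rule mult_mono)
          have "real (t - 2) * (D * sqrt D / 64) \<le> real t * (D * sqrt D / 64)"
            using D by (intro mult_right_mono) auto
          then show "real (t - 2) * m \<le> real t * (D * sqrt D / 64)" using mt3 by linarith
          show "2 * l ^ 2 * B \<le> 2 * l ^ 2 * D powr (27 / 64)" using B by (intro mult_left_mono) auto
        qed auto
        also have "\<dots> = (2 * real t * (l ^ 2 * D powr (27 / 64) / sqrt D)) * (D * (sqrt D * sqrt D) / 64)"
          using D by (simp add: field_simps)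
        also have "\<dots> \<le> 1 / 100 * (D * (sqrt D * sqrt D) / 64)"
          using elim(9) D by (intro mult_right_mono) (auto simp: l_def D_def)
        finally have "h * B * m \<le> D ^ 2 / 6400" using D by (simp add: power2_eq_square)
        then show ?thesis using zero_le_power2[of D] by linarith
      qed
      have b0m: "b0 * m \<le> 1 / 100 * (t * l)"
      proof -
        have "b0 * m = (exp \<theta> - 1) * (h * B * m * 2) / D" by (simp add: b0_def)
        also have "\<dots> \<le> (106 / 100 * \<theta>) * (D ^ 2 / 1600) / D"
          using e\<theta> hB \<theta> h0 LB0 D by (intro divide_right_mono mult_mono) auto
        also have "\<dots> = (106 / 160000) * (\<theta> * D)" using D by (simp add: power2_eq_square)
        also have "\<dots> \<le> 1 / 100 * (t * l)" using \<theta>(3) t l by simp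
        finally show ?thesis .
      qed
      \<comment> \<open>The main term stems from \<open>2 * D * D * \<rho>\<close> in
        \<open>S1\<close> and is bounded through \<open>m\<rho>\<close>; the terms with
        \<open>t - 2\<close> and \<open>h\<close> only add small constants.\<close>
      have b1m: "b1 * m \<le> 183 / 100 * (t * l)"
      proof -
        have "b1 * m = \<mu> * (2 * L * (2 * D * (m * \<rho>) + real (t - 2) * m) + h * B * m * 2)"
          using D by (simp add: b1_def S1_def field_simps)
        also have "\<dots> \<le> \<mu> * (2 * (106 / 100) * (2 * D * (D / 64) + real t * (D * sqrt D / 64)) + D ^ 2 / 1600)"
        proof -
          have "real (t - 2) * (D * sqrt D / 64) \<le> real t * (D * sqrt D / 64)"
            using D by (intro mult_right_mono) auto
          then have "real (t - 2) * m \<le> real t * (D * sqrt D / 64)" using mt3 by linarith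
          moreover have "2 * D * (m * \<rho>) \<le> 2 * D * (D / 64)"
            using m\<rho> D by (intro mult_left_mono) auto
          ultimately have "2 * D * (m * \<rho>) + real (t - 2) * m \<le> 2 * D * (D / 64) + real t * (D * sqrt D / 64)"
            by linarith
          then have "2 * L * (2 * D * (m * \<rho>) + real (t - 2) * m)
              \<le> 2 * (106 / 100) * (2 * D * (D / 64) + real t * (D * sqrt D / 64))"
            using L LB0 \<rho>0 D by (intro mult_mono) auto
          then show ?thesis using hB \<mu> by (intro mult_left_mono add_mono) auto
        qed
        also have "real t * (D * sqrt D / 64) \<le> D * D / 6400"
        proof -
          have "real t * 100 \<le> sqrt D" using elim(8) D by (simp add: D_def field_simps)
          then have "real t * 100 * (D * sqrt D / 6400) \<le> sqrt D * (D * sqrt D / 6400)"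
            using D by (intro mult_right_mono) auto
          then show ?thesis using D by simp
        qed
        then have "\<mu> * (2 * (106 / 100) * (2 * D * (D / 64) + real t * (D * sqrt D / 64)) + D ^ 2 / 1600)
          \<le> \<mu> * (2 * (106 / 100) * (2 * D * (D / 64) + D * D / 6400) + D ^ 2 / 1600)"
          using \<mu> D by (intro mult_left_mono add_mono) auto
        also have "\<dots> = 9 / 4 * (\<theta> * D) * (2 * (106 / 100) * (2 / 64 + 1 / 6400) + 1 / 1600)"
          using D by (simp add: \<mu>_def field_simps power2_eq_square)
        also have "\<dots> \<le> 183 / 100 * (t * l)"
          unfolding \<theta>(3) using t l by (simp add: field_simps)
        finally show ?thesis .
      qed
      have \<theta>t: "\<theta> * t \<le> 1 / 100 * (t * l)" and \<theta>1: "\<theta> \<le> 1 / 100 * (t * l)"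
      proof -
        have "12 * t / D \<le> 1 / 100" using elim(7) by (simp add: D_def)
        then have "12 * t / D * (t * l) \<le> 1 / 100 * (t * l)" using l by (intro mult_right_mono) auto
        then show "\<theta> * t \<le> 1 / 100 * (t * l)" by (simp add: \<theta>_def mult_ac)
        moreover have "\<theta> * 1 \<le> \<theta> * t" using \<theta> t by (intro mult_left_mono) auto
        ultimately show "\<theta> \<le> 1 / 100 * (t * l)" by simp
      qed
      have \<mu>m: "\<mu> * (real (t - 1) * m) \<le> 22 / 100 * (t * l)"
      proof -
        have "\<mu> * (real (t - 1) * m) \<le> \<mu> * (D ^ 2 / 128)" using tm \<mu> by (intro mult_left_mono) auto
        also have "\<dots> = 9 / 512 * (\<theta> * D)" using D by (simp add: \<mu>_def power2_eq_square)
        also have "\<dots> \<le> 22 / 100 * (t * l)" unfolding \<theta>(3) using t l by simp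
        finally show ?thesis .
      qed
      have tl: "2 * l \<le> t * l" using t l by (intro mult_right_mono) auto
      have "ln s - ln \<epsilon> \<le> 2 / 10 * l" using elim(10) l by (simp add: l_def D_def field_simps)
      then have lns: "ln s - ln \<epsilon> \<le> 1 / 10 * (t * l)" using tl by linarith
      have \<theta>D: "\<theta> * (D / 2 - \<Delta> - 1) = 6 * (t * l) - \<theta> * \<Delta> - \<theta>"
        using \<theta>(3) by (simp add: algebra_simps)
      have bm: "(b0 + b1) * m = b0 * m + b1 * m" by (simp add: algebra_simps)
      have \<mu>m': "\<mu> * (real (t - 1) * m + real \<Delta> * D) = \<mu> * (real (t - 1) * m) + \<mu> * \<Delta> * D"
        by (simp add: algebra_simps)
      \<comment> \<open>In units of \<open>t * l\<close>, and with \<open>ln \<epsilon>\<close>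
        moved to the left, the left side is below 5.4 and the right side above 5.8.\<close>
      have exponent: "ln s + 3 * (t * l) + (\<theta> * t + \<mu> * (real (t - 1) * m + real \<Delta> * D) + (b0 + b1) * m)
          \<le> ln \<epsilon> + \<theta> * (D / 2 - \<Delta> - 1)"
        unfolding \<theta>D bm \<mu>m' using lns \<theta>t \<mu>m \<mu>\<Delta>D b0m b1m \<theta>\<Delta> \<theta>1 tl l by linarith
      \<comment> \<open>The base is at most \<open>D ^ 3\<close>; this is the
        \<open>3 * (t * l)\<close> in \<open>exponent\<close>.\<close>
      have pow: "(real m * (D + 1)) ^ t \<le> exp (3 * (t * l))"
      proof -
        have "real m * (D + 1) \<le> D ^ 2 * (2 * D) / 128"
          using mult_mono[OF m128, of "D + 1" "2 * D"] D by simp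
        also have "\<dots> \<le> D ^ 3" using D by (simp add: power2_eq_square power3_eq_cube)
        finally have "(real m * (D + 1)) ^ t \<le> (D ^ 3) ^ t" using D by (intro power_mono) auto
        also have "\<dots> = exp l ^ (3 * t)" by (simp add: lD power_mult)
        also have "\<dots> = exp (3 * (t * l))" by (simp add: exp_of_nat_mult[symmetric] mult_ac)
        finally show ?thesis .
      qed
      have final: "s * (real m * (D + 1)) ^ t
          * exp (\<theta> * t + \<mu> * (real (t - 1) * m + real \<Delta> * D) + (b0 + b1) * m)
        \<le> \<epsilon> * exp (\<theta> * (D / 2 - \<Delta> - 1))" (is "?l * exp ?e \<le> _")
      proof -
        have "?l * exp ?e \<le> s * exp (3 * (t * l)) * exp ?e"
          using pow by (intro mult_right_mono mult_left_mono) auto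
        also have "\<dots> = exp (ln s + 3 * (t * l) + ?e)" using s by (simp add: exp_add)
        also have "\<dots> \<le> exp (ln \<epsilon> + \<theta> * (D / 2 - \<Delta> - 1))" using exponent by simp
        also have "\<dots> = \<epsilon> * exp (\<theta> * (D / 2 - \<Delta> - 1))" using \<epsilon> by (simp add: exp_add)
        finally show ?thesis .
      qed
      have dD: "real d = D" by (simp add: D_def)
      have "2 * t \<le> d" using D(2) unfolding D_def by linarith
      moreover have "2 * \<Delta> \<le> d" using t\<Delta> \<Delta>2 unfolding D_def by linarith
      moreover have "h * k = 2 * real (t - 2) * D" using l by (simp add: h_def k_def)
      moreover have "0 \<le> \<theta>" "0 \<le> \<mu>" using \<theta>(1) \<mu> by auto
      moreover have "2 / D * ((exp \<theta> - 1) * (h * exp (\<mu> * \<Delta> * D))) \<le> b0"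
        by (simp only: b0_def B_def order_refl)
      moreover have "2 / D * (\<mu> * (exp (\<mu> * \<Delta> * k) * S1 + h * D * exp (\<mu> * \<Delta> * D))) \<le> b1"
        by (simp only: b1_def B_def L_def order_refl)
      ultimately have "admissible s t d m \<Delta> \<epsilon> \<theta> \<mu> b0 b1 k h \<rho> S1"
        unfolding admissible_def dD
        using \<rho>0 \<rho>pow b0 b1 k0 \<rho>k cond[unfolded L_def] S1_def final
        by (intro conjI)
      then show "\<exists>\<theta> \<mu> b0 b1 k h \<rho> S1. admissible s t d m \<Delta> \<epsilon> \<theta> \<mu> b0 b1 k h \<rho> S1"
        by blast
    qed
  qed
qed

section \<open>Embedding in graphs without a complete bipartite subgraph\<close>

text \<open>Points of \<open>N v\<close> that are common chosen neighbours of \<open>t - 1\<close>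
  elements of \<open>A\<close> are also joined to \<open>v\<close>, so \<open>v\<close> serves as
  the last of \<open>t\<close> vertices and the edge bound applies with \<open>j = t - 1\<close>.
  For this \<open>v\<close> has to lie outside \<open>A\<close>.\<close>

lemma codegree_sum_le:
  assumes G: "pair_graph G" "Kst_free s t G" and "2 \<le> t" "1 \<le> s"
    and N: "\<And>v. v \<in> pverts G \<Longrightarrow> N v \<subseteq> neighbours G v \<and> card (N v) = d"
    and v: "v \<in> pverts G" and A: "A \<subseteq> pverts G - {v}"
    and \<rho>: "\<rho> > 0" "real d * \<rho> ^ (t - 1) = s"
  shows "(\<Sum>z\<in>A. real (card (N v \<inter> N z))) \<le> 2 * real (card A) * d * \<rho> + real (t - 2) * d"
proof -
  interpret pair_graph G by (rule G)
  have NV: "N u \<subseteq> pverts G" if "u \<in> pverts G" for u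
    using N[OF that] by (auto simp: neighbours_def dest: in_arcsD2)
  have finA: "finite A" and finN: "finite (N v)"
    using A NV[OF v] pair_finite_verts finite_subset by blast+
  have "real (\<Sum>z\<in>A. card {b \<in> N v. b \<in> N z}) \<le> 2 * real (card A) * d * \<rho> + real (t - 1 - 1) * d"
  proof (rule bipartite_edge_bound[OF finA finN])
    fix J assume J: "J \<subseteq> A" "card J = t - 1"
    have "v \<notin> J" "finite J" using J A finA finite_subset by blast+
    then have "card (insert v J) = t" using J \<open>2 \<le> t\<close> by simp
    moreover have "{b \<in> N v. \<forall>a\<in>J. b \<in> N a} \<times> insert v J \<subseteq> parcs G"
    proof clarify
      fix b u assume b: "b \<in> N v" "\<forall>a\<in>J. b \<in> N a" and "u \<in> insert v J"
      then have "u \<in> pverts G" "b \<in> N u" using J A v by auto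
      then show "(b, u) \<in> parcs G" using N by (auto simp: neighbours_def intro: arcs_symmetric)
    qed
    ultimately have "card {b \<in> N v. \<forall>a\<in>J. b \<in> N a} < s"
      using J A v \<open>2 \<le> t\<close> by (intro Kst_free_few_common[OF G, of "insert v J"]) auto
    then show "card {b \<in> N v. \<forall>a\<in>J. b \<in> N a} \<le> s" by simp
  qed (use assms in auto)
  moreover have "{b \<in> N v. b \<in> N z} = N v \<inter> N z" for z by auto
  ultimately show ?thesis by (simp add: numeral_2_eq_2)
qed

lemma card_common_in_neighbours_le:
  assumes G: "pair_graph G" "Kst_free s t G" and "2 \<le> t"
    and N: "\<And>v. v \<in> pverts G \<Longrightarrow> N v \<subseteq> neighbours G v" and "card J = t"
  shows "card {v \<in> pverts G. J \<subseteq> N v} \<le> s"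
proof (cases "{v \<in> pverts G. J \<subseteq> N v} = {}")
  \<comment> \<open>Only when some \<open>N v\<close> contains \<open>J\<close> is \<open>J\<close>
    known to consist of vertices of \<open>G\<close>.\<close>
  case False
  interpret pair_graph G by (rule G)
  have "{v \<in> pverts G. J \<subseteq> N v} \<times> J \<subseteq> parcs G"
    using N by (auto simp: neighbours_def)
  moreover from this False have "J \<subseteq> pverts G" by (auto dest: in_arcsD2)
  ultimately have "card {v \<in> pverts G. J \<subseteq> N v} < s"
    using assms by (intro Kst_free_few_common[OF G, of J]) auto
  then show ?thesis by simp
next
  case True
  show ?thesis unfolding True by simp
qed

lemma embedding_run_Kst_free:
  fixes G :: "'a pair_pre_digraph" and T :: "'b pair_pre_digraph"
    and \<rho> \<theta> \<mu> b0 b1 k h S1 :: real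
  assumes st: "2 \<le> t" "t \<le> s" and G: "pair_graph G" "Kst_free s t G" and T: "tree_graph T"
    and N: "\<And>v. v \<in> pverts G \<Longrightarrow> N v \<subseteq> neighbours G v \<and> card (N v) = d"
    and r: "r \<in> pverts T" and x: "x \<in> pverts G" and strategy: "valid_strategy T r pick ord"
    and \<rho>: "\<rho> > 0" "real d * \<rho> ^ (t - 1) = s" and d: "2 * t \<le> d" "2 * max_degree T \<le> d"
    and nonneg: "0 \<le> \<theta>" "0 \<le> \<mu>" "0 \<le> b0" "0 \<le> b1" "0 < k"
    and S1: "S1 = 2 * real d * d * \<rho> + real (t - 2) * d"
    and k: "4 * real d * \<rho> \<le> k" "h * k = 2 * real (t - 2) * d"
    and step: "2 / d * ((exp \<theta> - 1) * exp (\<mu> * max_degree T * k)) \<le> \<mu>"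
      "2 / d * ((exp \<theta> - 1) * (h * exp (\<mu> * max_degree T * d))) \<le> b0"
      "2 / d * (\<mu> * (exp (\<mu> * max_degree T * k) * S1 + h * d * exp (\<mu> * max_degree T * d))) \<le> b1"
  shows "embedding_run (pverts G) N T r (\<lambda>y. THE u. y \<in> children T r u) d t
    (s * (card (pverts T) * (d + 1)) ^ t) (max_degree T) \<theta> \<mu> b0 b1 k h S1 G x pick ord"
proof -
  interpret G: pair_graph G by (rule G)
  interpret T: pair_graph T using T by (simp add: tree_graph_def)
  have par: "(THE u. y \<in> children T r u) = u" if "y \<in> children T r u" for y u
    using that parent_unique[OF T r] by blast
  have NV: "N v \<subseteq> pverts G" if "v \<in> pverts G" for v
    using N[OF that] by (auto simp: neighbours_def dest: G.in_arcsD2)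
  show ?thesis
  proof unfold_locales
    fix u
    define C where "C = {y \<in> pverts T. y \<noteq> r \<and> (THE u. y \<in> children T r u) = u}"
    have C: "C \<subseteq> children T r u"
    proof
      fix y assume "y \<in> C"
      then have y: "y \<in> pverts T" "y \<noteq> r" "(THE u. y \<in> children T r u) = u" by (auto simp: C_def)
      show "y \<in> children T r u" using parent_exists[OF T r y(1,2)] par y(3) by blast
    qed
    have "card C \<le> max_degree T"
    proof (cases "C = {}")
      case False
      then have "u \<in> pverts T"
        using C children_subset_neighbours[OF T r] by (fastforce simp: neighbours_def dest: T.in_arcsD1)
      from card_children_le_max_degree[OF T r this] show ?thesis
        using C card_mono order_trans by blast
    qed simp
    then show "card {y \<in> pverts T. y \<noteq> r \<and> (THE u. y \<in> children T r u) = u} \<le> max_degree T"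
      by (simp add: C_def)
  next
    fix Z assume Z: "Z \<subseteq> pverts G" "card Z \<le> card (pverts T) * (d + 1)"
    have "finite Z" using Z G.pair_finite_verts finite_subset by blast
    then have "card {v \<in> pverts G. t \<le> card (N v \<inter> Z)} \<le> s * card Z ^ t"
      using G.pair_finite_verts N st
      by (intro card_many_neighbours_le card_common_in_neighbours_le[OF G]) auto
    also have "\<dots> \<le> s * (card (pverts T) * (d + 1)) ^ t"
      using Z by (intro mult_left_mono power_mono) auto
    finally show "card {v \<in> pverts G. t \<le> card (N v \<inter> Z)} \<le> s * (card (pverts T) * (d + 1)) ^ t" .
  next
    fix v w assume vw: "v \<in> pverts G" "w \<in> pverts G"
    have fin: "finite (N w)" using NV[OF vw(2)] G.pair_finite_verts finite_subset by blast
    \<comment> \<open>Used twice: for all of \<open>N w - {v}\<close>, and for the heavy points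
      alone.\<close>
    have bound: "(\<Sum>z\<in>A. real (card (N v \<inter> N z))) \<le> 2 * real (card A) * d * \<rho> + real (t - 2) * d"
      if "A \<subseteq> N w - {v}" for A
      using that NV[OF vw(2)] vw st by (intro codegree_sum_le[OF G _ _ N _ _ \<rho>]) auto
    have "(\<Sum>z\<in>N w. if v = z then 0 else real (card (N v \<inter> N z)))
        = (\<Sum>z\<in>N w - {v}. real (card (N v \<inter> N z)))"
      using fin by (intro sum.mono_neutral_cong_right) auto
    also have "\<dots> \<le> 2 * real (card (N w - {v})) * d * \<rho> + real (t - 2) * d"
      by (intro bound) auto
    also have "\<dots> \<le> S1"
      unfolding S1 using \<rho> N[OF vw(2)] fin card_Diff1_le[of "N w" v]
      by (intro add_right_mono mult_right_mono) auto
    finally show "(\<Sum>z\<in>N w. if v = z then 0 else real (card (N v \<inter> N z))) \<le> S1" .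
    define H where "H = {z \<in> N w. v \<noteq> z \<and> k < real (card (N v \<inter> N z))}"
    have "card H * k \<le> (\<Sum>z\<in>H. real (card (N v \<inter> N z)))"
      using sum_mono[of H "\<lambda>_. k" "\<lambda>z. real (card (N v \<inter> N z))"] by (auto simp: H_def)
    also have "\<dots> \<le> 2 * real (card H) * d * \<rho> + real (t - 2) * d"
      by (intro bound) (auto simp: H_def)
    \<comment> \<open>As \<open>4 * d * \<rho> \<le> k\<close>, the first term takes up only half of
      \<open>card H * k\<close>, and the other half gives \<open>card H \<le> h\<close>.\<close>
    also have "\<dots> = card H * (4 * real d * \<rho>) / 2 + h * k / 2" using k by simp
    also have "\<dots> \<le> card H * k / 2 + h * k / 2"
      using k by (intro add_right_mono divide_right_mono mult_left_mono) auto
    finally have "card H * k \<le> h * k" by simp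
    then have "card H \<le> h" using nonneg by simp
    then show "real (card {z \<in> N w. v \<noteq> z \<and> k < real (card (N v \<inter> N z))}) \<le> h"
      by (simp add: H_def)
  qed (use assms NV par T.pair_finite_verts G.pair_finite_verts in auto)
qed

theorem theorem3p1:
  fixes s t :: nat
  assumes "2 \<le> t" and "t \<le> s"
  shows "\<forall>\<epsilon>>0. \<forall>\<^sub>F d in sequentially.
    \<forall>(G :: 'a pair_pre_digraph) (T :: 'b pair_pre_digraph) Np r x pick ord.
      pair_graph G \<longrightarrow> Kst_free s t G \<longrightarrow> min_degree G = d \<longrightarrow>
      tree_graph T \<longrightarrow>
      real (card (pverts T))
        \<le> 1 / 64 * real s powr (- 1 / (real t - 1)) * real d powr (real t / (real t - 1)) \<longrightarrow>
      real (max_degree T) \<le> 1 / (64 * real t) * real d \<longrightarrow>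
      (\<forall>v \<in> pverts G. Np v \<subseteq> neighbours G v \<and> card (Np v) = d) \<longrightarrow>
      r \<in> pverts T \<longrightarrow> x \<in> pverts G \<longrightarrow> valid_strategy T r pick ord \<longrightarrow>
      measure (measure_spmf (algorithm2 T Np r x pick ord)) {f. is_embedding T G f} \<ge> 1 - \<epsilon>"
proof (intro allI impI)
  fix \<epsilon> :: real
  assume "\<epsilon> > 0"
  then have "\<forall>\<^sub>F d in sequentially. \<forall>m \<Delta> :: nat.
    real m \<le> 1 / 64 * real s powr (- 1 / (real t - 1)) * real d powr (real t / (real t - 1)) \<longrightarrow>
    real \<Delta> \<le> 1 / (64 * real t) * real d \<longrightarrow>
    (\<exists>\<theta> \<mu> b0 b1 k h \<rho> S1. admissible s t d m \<Delta> \<epsilon> \<theta> \<mu> b0 b1 k h \<rho> S1)"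
    using assms by (intro eventually_parameters) auto
  then show "\<forall>\<^sub>F d in sequentially.
    \<forall>(G :: 'a pair_pre_digraph) (T :: 'b pair_pre_digraph) Np r x pick ord.
      pair_graph G \<longrightarrow> Kst_free s t G \<longrightarrow> min_degree G = d \<longrightarrow>
      tree_graph T \<longrightarrow>
      real (card (pverts T))
        \<le> 1 / 64 * real s powr (- 1 / (real t - 1)) * real d powr (real t / (real t - 1)) \<longrightarrow>
      real (max_degree T) \<le> 1 / (64 * real t) * real d \<longrightarrow>
      (\<forall>v \<in> pverts G. Np v \<subseteq> neighbours G v \<and> card (Np v) = d) \<longrightarrow>
      r \<in> pverts T \<longrightarrow> x \<in> pverts G \<longrightarrow> valid_strategy T r pick ord \<longrightarrow>
      measure (measure_spmf (algorithm2 T Np r x pick ord)) {f. is_embedding T G f} \<ge> 1 - \<epsilon>"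
  proof (rule eventually_mono, intro allI impI)
    fix d and G :: "'a pair_pre_digraph" and T :: "'b pair_pre_digraph" and Np r x
      and pick :: "('b, 'a) history \<Rightarrow> 'b" and ord :: "('b, 'a) history \<Rightarrow> 'b \<Rightarrow> 'b list"
    define m where "m = card (pverts T)"
    define \<Delta> where "\<Delta> = max_degree T"
    assume "\<forall>m \<Delta> :: nat.
      real m \<le> 1 / 64 * real s powr (- 1 / (real t - 1)) * real d powr (real t / (real t - 1)) \<longrightarrow>
      real \<Delta> \<le> 1 / (64 * real t) * real d \<longrightarrow>
      (\<exists>\<theta> \<mu> b0 b1 k h \<rho> S1. admissible s t d m \<Delta> \<epsilon> \<theta> \<mu> b0 b1 k h \<rho> S1)"
      and "real (card (pverts T))
        \<le> 1 / 64 * real s powr (- 1 / (real t - 1)) * real d powr (real t / (real t - 1))"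
      and "real (max_degree T) \<le> 1 / (64 * real t) * real d"
    then obtain \<theta> \<mu> b0 b1 k h \<rho> S1 where adm: "admissible s t d m \<Delta> \<epsilon> \<theta> \<mu> b0 b1 k h \<rho> S1"
      unfolding m_def \<Delta>_def by blast
    assume "pair_graph G" "Kst_free s t G" "tree_graph T"
      "\<forall>v \<in> pverts G. Np v \<subseteq> neighbours G v \<and> card (Np v) = d"
      "r \<in> pverts T" "x \<in> pverts G" "valid_strategy T r pick ord"
    then interpret embedding_run "pverts G" Np T r "\<lambda>y. THE u. y \<in> children T r u" d t
      "s * (m * (d + 1)) ^ t" \<Delta> \<theta> \<mu> b0 b1 k h S1 G x pick ord
      using assms adm unfolding m_def \<Delta>_def admissible_def
      by (intro embedding_run_Kst_free) auto
    \<comment> \<open>The last clause of \<open>admissible\<close> is what makes the failure bound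
      of \<open>algorithm2_success\<close> at most \<open>\<epsilon>\<close>.\<close>
    have "real (s * (m * (d + 1)) ^ t) * entry \<le> \<epsilon> * threshold"
      using adm unfolding admissible_def entry_def threshold_def m_def
      by (simp only: of_nat_mult of_nat_power of_nat_add of_nat_1 mult.assoc)
    then have "real (s * (m * (d + 1)) ^ t) * entry / threshold \<le> \<epsilon>"
      using threshold_pos by (simp add: pos_divide_le_eq)
    then show "measure (measure_spmf (algorithm2 T Np r x pick ord)) {f. is_embedding T G f} \<ge> 1 - \<epsilon>"
      using algorithm2_success by linarith
  qed
qed

end
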